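(* Let $A\in\mathbb C^{m\times m}$ be a complex symmetric matrix, and let $\mathcal D$ be the set of $w=(w_1,\dots,w_m)$ with all $w_k>0$ such that all singular values of $A_W=WAW$, $W=\operatorname{diag}(\sqrt{w_1},\dots,\sqrt{w_m})$, lie in $[0,1)$. For $w\in\mathcal D$ and $\bar n\in\mathbb Z_{\ge0}^m$ let $$P_{A,W}(\bar n)=\frac1{\mathcal Z}\,|\mathrm{Haf}(A_{\bar n})|^2\prod_{i=1}^m\frac{w_i^{n_i}}{n_i!},\qquad \frac1{\mathcal Z}=\sqrt{\det(\mathbb 1-X\mathcal A_W)},\quad \mathcal A_W=A_W\oplus A_W^*.$$ Then for every $w\in\mathcal D$, every $\bar n\in\mathbb Z_{\ge0}^m$ and every $k\in\{1,\dots,m\}$, $$\partial_{w_k}P_{A,W}(\bar n)=\frac{n_k-\langle n_k\rangle}{w_k}\,P_{A,W}(\bar n),\qquad \langle n_k\rangle=\frac{V_{k,k}+V_{k+m,k+m}-1}{2},$$ where $V=(\mathbb 1-X\mathcal A_W)^{-1}-\mathbb 1/2$. Consequently, if $w=w(\theta)$ is a differentiable function of parameters $\theta=(\theta_1,\dots,\theta_d)$ in an open set with values in $\mathcal D$, then $$\partial_\theta P_{A,W}(\bar n)=\sum_{k=1}^m\left(n_k-\langle n_k\rangle\right)P_{A,W}(\bar n)\,\partial_\theta\log w_k .$$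
   Context: $\partial_\theta$ denotes the gradient $(\partial/\partial\theta_1,\dots,\partial/\partial\theta_d)$. $X=\begin{pmatrix}0&\mathbb 1_m\\ \mathbb 1_m&0\end{pmatrix}$ and $A_W^*$ is the entrywise complex conjugate. For a symmetric matrix $B$ of even size $2r$, $\mathrm{Haf}(B)=\sum_\mu\prod_{\{i,j\}\in\mu}B_{ij}$, the sum running over all partitions $\mu$ of $\{1,\dots,2r\}$ into two-element subsets; $\mathrm{Haf}$ of the empty matrix is $1$ and $\mathrm{Haf}$ of an odd-size matrix is $0$. $A_{\bar n}$ is obtained from $A$ by repeating the $i$-th row and column $n_i$ times (deleting them if $n_i=0$). $P_{A,W}$ is the photon-number distribution of the pure $m$-mode Gaussian state with covariance matrix $V$, and $\langle n_k\rangle$ is the average number of photons in mode $k$ for that state. *)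

theory Defs
  imports "HOL-Analysis.Analysis"
begin

definition perfect_matchings :: "'i set \<Rightarrow> 'i set set set" where
  "perfect_matchings I = {\<mu>. partition_on I \<mu> \<and> (\<forall>e\<in>\<mu>. card e = 2)}"

text \<open>
  The entry of \<open>B\<close> at an unordered pair \<open>{i, j}\<close>. The description is unique when \<open>B\<close> is symmetric,
  which is the only case in which it is used.
\<close>

definition edge_entry :: "('i \<Rightarrow> 'i \<Rightarrow> complex) \<Rightarrow> 'i set \<Rightarrow> complex" where
  "edge_entry B e = (THE b. \<exists>i j. e = {i, j} \<and> b = B i j)"

text \<open>
  A matrix is given by its finite index set \<open>I\<close> and its entries. If \<open>I\<close> is empty, the empty partition
  is the only matching and the value is 1; if \<open>card I\<close> is odd, there is no matching and the value is 0.
\<close>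

definition Haf :: "'i set \<Rightarrow> ('i \<Rightarrow> 'i \<Rightarrow> complex) \<Rightarrow> complex" where
  "Haf I B = (\<Sum>\<mu>\<in>perfect_matchings I. \<Prod>e\<in>\<mu>. edge_entry B e)"

lemma edge_entry_pair:
  assumes "\<And>i j. B i j = B j i"
  shows "edge_entry B {i, j} = B i j"
  unfolding edge_entry_def by (rule the_equality) (use assms in \<open>auto simp: doubleton_eq_iff\<close>)

text \<open>
  The matrix obtained from \<open>A\<close> by repeating the \<open>i\<close>-th row and column \<open>n $ i\<close> times: its rows and
  columns are indexed by the pairs \<open>(i, a)\<close>, the \<open>a\<close>-th copy of \<open>i\<close>.
\<close>

definition copies :: "nat ^ 'm \<Rightarrow> ('m \<times> nat) set" where
  "copies n = {(i, a). a < n $ i}"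

definition repeated :: "complex ^ 'm ^ 'm \<Rightarrow> ('m \<times> nat) \<Rightarrow> ('m \<times> nat) \<Rightarrow> complex" where
  "repeated A p q = A $ fst p $ fst q"

definition Haf_rep :: "complex ^ 'm ^ 'm \<Rightarrow> nat ^ 'm \<Rightarrow> complex" where
  "Haf_rep A n = Haf (copies n) (repeated A)"

definition singular_value :: "complex ^ 'n ^ 'n \<Rightarrow> real \<Rightarrow> bool" where
  "singular_value M s \<longleftrightarrow>
     s \<ge> 0 \<and> (\<exists>v. v \<noteq> 0 \<and> (map_matrix cnj (transpose M) ** M) *v v = of_real (s\<^sup>2) *s v)"

text \<open>
  Matrices of size \<open>2m\<close> are indexed by \<open>'m + 'm\<close>, with \<open>Inl k\<close> for the index \<open>k\<close> and \<open>Inr k\<close> for the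
  index \<open>k + m\<close>.
\<close>

definition block ::
  "complex ^ 'm ^ 'm \<Rightarrow> complex ^ 'm ^ 'm \<Rightarrow> complex ^ 'm ^ 'm \<Rightarrow> complex ^ 'm ^ 'm \<Rightarrow>
     complex ^ ('m + 'm) ^ ('m + 'm)" where
  "block P Q R S = (\<chi> p q. case p of
      Inl i \<Rightarrow> (case q of Inl j \<Rightarrow> P $ i $ j | Inr j \<Rightarrow> Q $ i $ j)
    | Inr i \<Rightarrow> (case q of Inl j \<Rightarrow> R $ i $ j | Inr j \<Rightarrow> S $ i $ j))"

definition X_mat :: "complex ^ ('m::finite + 'm) ^ ('m + 'm)" where
  "X_mat = block 0 (mat 1) (mat 1) 0"

definition W_mat :: "real ^ 'm \<Rightarrow> complex ^ 'm ^ 'm" where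
  "W_mat w = (\<chi> i j. if i = j then of_real (sqrt (w $ i)) else 0)"

definition A_W :: "complex ^ 'm ^ 'm \<Rightarrow> real ^ 'm \<Rightarrow> complex ^ 'm ^ 'm" where
  "A_W A w = W_mat w ** A ** W_mat w"

definition calA_W :: "complex ^ 'm ^ 'm \<Rightarrow> real ^ 'm \<Rightarrow> complex ^ ('m + 'm) ^ ('m + 'm)" where
  "calA_W A w = block (A_W A w) 0 0 (map_matrix cnj (A_W A w))"

definition weight_domain :: "complex ^ 'm ^ 'm \<Rightarrow> (real ^ 'm) set" where
  "weight_domain A =
     {w. (\<forall>k. 0 < w $ k) \<and> (\<forall>s. singular_value (A_W A w) s \<longrightarrow> s \<in> {0..<1})}"

text \<open>
  The determinant is always a real number (\<open>det_real\<close> below), so taking its real part loses nothing.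
\<close>

definition inv_Z :: "complex ^ 'm ^ 'm \<Rightarrow> real ^ 'm \<Rightarrow> real" where
  "inv_Z A w = sqrt (Re (det (mat 1 - X_mat ** calA_W A w)))"

definition P_AW :: "complex ^ 'm ^ 'm \<Rightarrow> real ^ 'm \<Rightarrow> nat ^ 'm \<Rightarrow> real" where
  "P_AW A w n =
     inv_Z A w * (cmod (Haf_rep A n))\<^sup>2 * (\<Prod>i\<in>UNIV. (w $ i) ^ (n $ i) / fact (n $ i))"

text \<open>
  The expectation of \<open>n $ k\<close> under \<open>P_AW A w\<close>. An infinite sum that does not converge has the
  junk value 0, so statements about it also assert summability.
\<close>

definition mean_photons :: "complex ^ 'm ^ 'm \<Rightarrow> real ^ 'm \<Rightarrow> 'm \<Rightarrow> real" where
  "mean_photons A w k = (\<Sum>\<^sub>\<infinity>n\<in>UNIV. real (n $ k) * P_AW A w n)"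

definition cov_V :: "complex ^ 'm ^ 'm \<Rightarrow> real ^ 'm \<Rightarrow> complex ^ ('m + 'm) ^ ('m + 'm)" where
  "cov_V A w = matrix_inv (mat 1 - X_mat ** calA_W A w) - mat (1 / 2)"

definition gradient :: "(real ^ 'd \<Rightarrow> real) \<Rightarrow> real ^ 'd \<Rightarrow> real ^ 'd" where
  "gradient f \<theta> = (\<chi> j. deriv (\<lambda>t. f (\<theta> + t *\<^sub>R axis j 1)) 0)"

lemma X_mat_calA_W:
  "X_mat ** calA_W A w = block 0 (map_matrix cnj (A_W A w)) (A_W A w) 0"
proof -
  have "(X_mat ** calA_W A w) $ p $ q = block 0 (map_matrix cnj (A_W A w)) (A_W A w) 0 $ p $ q" for p q
    by (cases p; cases q)
       (simp_all add: matrix_matrix_mult_def X_mat_def calA_W_def block_def mat_def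
          UNIV_Plus_UNIV [symmetric] sum.Plus if_distrib [where f = "\<lambda>x. x * _"] cong: if_cong
          del: UNIV_Plus_UNIV)
  then show ?thesis
    by (simp add: vec_eq_iff)
qed

lemma det_map_cnj: "det (map_matrix cnj M) = cnj (det M)"
  by (simp add: det_def)

lemma det_real: "Im (det (mat 1 - X_mat ** calA_W A w)) = 0"
proof -
  define M where "M = mat 1 - X_mat ** calA_W A w"
  have XX: "X_mat ** X_mat = (mat 1 :: complex ^ ('a + 'a) ^ ('a + 'a))"
  proof -
    have "(X_mat ** X_mat :: complex ^ ('a + 'a) ^ ('a + 'a)) $ p $ q = mat 1 $ p $ q" for p q
      by (cases p; cases q)
         (simp_all add: matrix_matrix_mult_def X_mat_def block_def mat_def
            UNIV_Plus_UNIV [symmetric] sum.Plus if_distrib [where f = "\<lambda>x. x * _"] cong: if_cong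
            del: UNIV_Plus_UNIV)
    then show ?thesis
      by (simp add: vec_eq_iff)
  qed
  have "(X_mat ** M) $ p $ q = (map_matrix cnj M ** X_mat) $ p $ q" for p q
    unfolding M_def X_mat_calA_W
    by (cases p; cases q)
       (simp_all add: matrix_matrix_mult_def X_mat_def block_def mat_def
          UNIV_Plus_UNIV [symmetric] sum.Plus if_distrib [where f = "\<lambda>x. x * _"]
          if_distrib [where f = "\<lambda>x. _ * x"] if_distrib [where f = cnj] sum_negf cong: if_cong
          del: UNIV_Plus_UNIV)
  then have "X_mat ** M = map_matrix cnj M ** X_mat"
    by (simp add: vec_eq_iff)
  then have "det (X_mat :: complex ^ ('a + 'a) ^ ('a + 'a)) * det M = cnj (det M) * det (X_mat :: complex ^ ('a + 'a) ^ ('a + 'a))"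
    by (metis det_mul det_map_cnj)
  moreover have "det (X_mat :: complex ^ ('a + 'a) ^ ('a + 'a)) \<noteq> 0"
    by (metis XX det_mul det_I mult_zero_left zero_neq_one)
  ultimately have "cnj (det M) = det M"
    by simp
  then show ?thesis
    by (simp add: M_def complex_eq_iff)
qed

end

theory Submission
  imports Defs
begin

text \<open>
  The numbers \<open>c n = Haf_rep A n * sqrt (\<Prod>i. w\<^sub>i ^ n\<^sub>i / n\<^sub>i!)\<close> are the photon-number amplitudes of a squeezed state:
  expanding the Hafnian along one row says that the annihilation operators act on them as \<open>a\<^sub>k c = \<Sum>j. B\<^sub>k\<^sub>j a\<^sub>j\<^sup>\<dagger> c\<close>
  with \<open>B = A_W A w\<close>. Comparing norms of both sides level by level in the total photon number gives
  summability, because \<open>B\<close> has operator norm below 1. Together with the canonical commutation relations the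
  same identity is a linear system for the second moments of \<open>c\<close>, which exhibits them as the entries
  of \<open>(1 - X \<A>\<^sub>W)\<^sup>-\<^sup>1\<close> times the squared norm of \<open>c\<close>. Scaling \<open>w\<close> down to \<open>0\<close> turns this into a differential
  equation for that squared norm, solved by \<open>det (1 - X \<A>\<^sub>W) powr (-1/2)\<close>; hence \<open>P_AW\<close> is normalised and
  \<open>\<langle>n\<^sub>k\<rangle>\<close> is read off from \<open>V\<close>. The derivative of \<open>P_AW\<close> then follows from Jacobi's formula for the determinant.
\<close>

section \<open>Hafnian expansion\<close>

lemma finite_perfect_matchings:
  assumes "finite I"
  shows "finite (perfect_matchings I)"
proof (rule finite_subset)
  show "perfect_matchings I \<subseteq> Pow (Pow I)"
    by (auto simp: perfect_matchings_def partition_on_def)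
qed (use assms in auto)

lemma insert_edge_perfect_matching:
  assumes "p \<in> I" "q \<in> I - {p}" "\<nu> \<in> perfect_matchings (I - {p, q})"
  shows "insert {p, q} \<nu> \<in> perfect_matchings I"
proof -
  have "disjnt {p, q} e" if "e \<in> \<nu>" for e
    using that assms(3) unfolding perfect_matchings_def partition_on_def disjnt_def by blast
  then show ?thesis
    using assms unfolding perfect_matchings_def partition_on_def
    by (auto simp: disjoint_def disjnt_def)
qed

lemma perfect_matchings_split:
  assumes "p \<in> I" "\<mu> \<in> perfect_matchings I"
  obtains q \<nu> where "q \<in> I - {p}" "\<nu> \<in> perfect_matchings (I - {p, q})" "\<mu> = insert {p, q} \<nu>"
proof -
  from assms obtain e where e: "e \<in> \<mu>" "p \<in> e"
    unfolding perfect_matchings_def partition_on_def by blast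
  with assms have "card e = 2"
    by (auto simp: perfect_matchings_def)
  with e obtain q where q: "e = {p, q}" "q \<noteq> p"
    by (auto simp: card_2_iff doubleton_eq_iff)
  have "q \<in> I - {p}"
    using q e assms by (auto simp: perfect_matchings_def partition_on_def)
  moreover have "\<mu> - {e} \<in> perfect_matchings (I - {p, q})"
  proof -
    have dis: "disjoint \<mu>" and cov: "\<Union>\<mu> = I"
      using assms by (auto simp: perfect_matchings_def partition_on_def)
    have "e' \<inter> e = {}" if "e' \<in> \<mu> - {e}" for e'
      using disjointD[OF dis, of e' e] that e by auto
    then have "\<Union>(\<mu> - {e}) = I - e"
      using cov e(1) by blast
    moreover have "disjoint (\<mu> - {e})"
      using dis by (auto simp: disjoint_def)
    ultimately show ?thesis
      using assms q(1) by (auto simp: perfect_matchings_def partition_on_def)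
  qed
  moreover have "\<mu> = insert {p, q} (\<mu> - {e})"
    using e q by auto
  ultimately show ?thesis
    by (rule that)
qed

text \<open>No edge of a matching of \<open>I - {p, q}\<close> contains \<open>p\<close>, so the
  edge through \<open>p\<close>, and with it the partner \<open>q\<close>, can be read off from the
  enlarged matching.\<close>

lemma perfect_matchings_insert_inj:
  assumes "p \<in> I"
    "q \<in> I - {p}" "\<nu> \<in> perfect_matchings (I - {p, q})"
    "q' \<in> I - {p}" "\<nu>' \<in> perfect_matchings (I - {p, q'})"
    "insert {p, q} \<nu> = insert {p, q'} \<nu>'"
  shows "q = q' \<and> \<nu> = \<nu>'"
proof -
  have notin: "e \<notin> \<nu> \<and> e \<notin> \<nu>'" if "p \<in> e" for e
    using assms that by (auto simp: perfect_matchings_def partition_on_def)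
  have "{p, q} \<in> insert {p, q'} \<nu>'"
    using assms(6) by blast
  then have "{p, q} = {p, q'}"
    using notin[of "{p, q}"] by simp
  then have "q = q'"
    by (auto simp: doubleton_eq_iff)
  then show ?thesis
    using assms(6) notin[of "{p, q}"] insert_ident[of "{p, q}" \<nu> \<nu>'] by simp
qed

text \<open>Matchings of \<open>I\<close> are classified by the partner \<open>q\<close> of the
  fixed index \<open>p\<close>; what remains is an arbitrary matching of
  \<open>I - {p, q}\<close>.\<close>

lemma Haf_expand:
  fixes B :: "'i \<Rightarrow> 'i \<Rightarrow> complex"
  assumes sym: "\<And>i j. B i j = B j i" and fin: "finite I" and p: "p \<in> I"
  shows "Haf I B = (\<Sum>q\<in>I - {p}. B p q * Haf (I - {p, q}) B)"
proof -
  let ?S = "Sigma (I - {p}) (\<lambda>q. perfect_matchings (I - {p, q}))"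
  let ?g = "\<lambda>(q, \<nu>). insert {p, q} \<nu>"
  have inj: "inj_on ?g ?S"
    using perfect_matchings_insert_inj[OF p] by (auto simp: inj_on_def)
  have "perfect_matchings I = ?g ` ?S"
  proof
    show "perfect_matchings I \<subseteq> ?g ` ?S"
    proof
      fix \<mu> assume "\<mu> \<in> perfect_matchings I"
      from p this obtain q \<nu> where "q \<in> I - {p}" "\<nu> \<in> perfect_matchings (I - {p, q})"
          "\<mu> = insert {p, q} \<nu>"
        by (rule perfect_matchings_split)
      then show "\<mu> \<in> ?g ` ?S"
        by force
    qed
  qed (use insert_edge_perfect_matching[OF p] in auto)
  then have "Haf I B = (\<Sum>x\<in>?S. \<Prod>e\<in>?g x. edge_entry B e)"
    by (simp add: Haf_def sum.reindex[OF inj] o_def)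
  also have "\<dots> = (\<Sum>(q, \<nu>)\<in>?S. B p q * (\<Prod>e\<in>\<nu>. edge_entry B e))"
  proof (rule sum.cong[OF refl])
    fix x assume "x \<in> ?S"
    then obtain q \<nu> where x: "x = (q, \<nu>)" and \<nu>: "\<nu> \<in> perfect_matchings (I - {p, q})"
      by blast
    have "{p, q} \<notin> \<nu>"
      using \<nu> by (auto simp: perfect_matchings_def partition_on_def)
    moreover have "\<nu> \<subseteq> Pow I"
      using \<nu> by (auto simp: perfect_matchings_def partition_on_def)
    then have "finite \<nu>"
      using fin finite_subset by blast
    ultimately show "(\<Prod>e\<in>?g x. edge_entry B e)
        = (case x of (q, \<nu>) \<Rightarrow> B p q * (\<Prod>e\<in>\<nu>. edge_entry B e))"
      using edge_entry_pair[of B p q] sym by (simp add: x)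
  qed
  also have "\<dots> = (\<Sum>q\<in>I - {p}. \<Sum>\<nu>\<in>perfect_matchings (I - {p, q}). B p q * (\<Prod>e\<in>\<nu>. edge_entry B e))"
    by (rule sum.Sigma [symmetric]) (use fin finite_perfect_matchings in auto)
  finally show ?thesis
    by (simp add: Haf_def sum_distrib_left)
qed

lemma perfect_matchings_empty: "perfect_matchings {} = {{}}"
  by (auto simp: perfect_matchings_def partition_on_def)

lemma Haf_empty [simp]: "Haf {} B = 1"
  by (simp add: Haf_def perfect_matchings_empty)

text \<open>Removing a copy of an index leaves a gap in the numbering of its copies; invariance
  under relabelling closes the gap. Expanding both Hafnians along corresponding rows reduces the
  claim to smaller index sets.\<close>

lemma Haf_reindex:
  assumes "finite I" "bij_betw g I J"
    and "\<And>i j. B i j = B j i" "\<And>i j. C i j = C j i"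
    and "\<And>i j. i \<in> I \<Longrightarrow> j \<in> I \<Longrightarrow> C (g i) (g j) = B i j"
  shows "Haf J C = Haf I B"
  using assms
proof (induction "card I" arbitrary: I J rule: less_induct)
  case less
  show ?case
  proof (cases "I = {}")
    case True
    then show ?thesis
      using less.prems by (auto simp: bij_betw_def)
  next
    case False
    then obtain p where p: "p \<in> I"
      by blast
    have J: "finite J" "g p \<in> J"
      using less.prems p by (auto simp: bij_betw_def)
    have bij: "bij_betw g (I - {p}) (J - {g p})"
      using less.prems(2) p by (auto simp: bij_betw_def inj_on_def)
    have "Haf J C = (\<Sum>q\<in>J - {g p}. C (g p) q * Haf (J - {g p, q}) C)"
      using less.prems J by (intro Haf_expand) auto
    also have "\<dots> = (\<Sum>q\<in>I - {p}. C (g p) (g q) * Haf (J - {g p, g q}) C)"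
      by (rule sum.reindex_bij_betw[OF bij, symmetric])
    also have "\<dots> = (\<Sum>q\<in>I - {p}. B p q * Haf (I - {p, q}) B)"
    proof (rule sum.cong)
      fix q assume q: "q \<in> I - {p}"
      have "bij_betw g {p, q} {g p, g q}"
        using less.prems(2) p q by (auto simp: bij_betw_def inj_on_def)
      then have "bij_betw g (I - {p, q}) (J - {g p, g q})"
        using less.prems(2) p q J by (intro bij_betw_DiffI) (auto simp: bij_betw_def)
      moreover have "card (I - {p, q}) < card I"
        using less.prems(1) p by (intro psubset_card_mono) auto
      ultimately have "Haf (J - {g p, g q}) C = Haf (I - {p, q}) B"
        using less.prems by (intro less.hyps) auto
      then show "C (g p) (g q) * Haf (J - {g p, g q}) C = B p q * Haf (I - {p, q}) B"
        using less.prems p q by simp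
    qed simp
    also have "\<dots> = Haf I B"
      using less.prems p by (intro Haf_expand[symmetric]) auto
    finally show ?thesis .
  qed
qed

lemma Haf_rep_zero: "Haf_rep A 0 = 1"
  by (simp add: Haf_rep_def copies_def)

lemma finite_copies: "finite (copies n)"
proof -
  have "copies n = (SIGMA i:UNIV. {..<n $ i})"
    by (auto simp: copies_def)
  then show ?thesis
    by simp
qed

text \<open>The row of the last copy \<open>(k, n $ k)\<close> is expanded. Its \<open>n $ j\<close>
  possible partners among the copies of \<open>j\<close> all give the same term, hence the factor
  \<open>of_nat (n $ j)\<close>. This factor also removes the terms with \<open>n $ j = 0\<close>,
  where \<open>n - axis j 1\<close> is truncated.\<close>

lemma Haf_rep_step:
  fixes A :: "complex ^ 'm ^ 'm"
  assumes sym: "transpose A = A"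
  shows "Haf_rep A (n + axis k 1) = (\<Sum>j\<in>UNIV. A $ k $ j * (of_nat (n $ j) * Haf_rep A (n - axis j 1)))"
proof -
  let ?B = "repeated A"
  have B: "?B i j = ?B j i" for i j
    using sym unfolding repeated_def by (metis transpose_def vec_lambda_beta)
  define p where "p = (k, n $ k)"
  have rest: "copies (n + axis k 1) - {p} = (SIGMA j:UNIV. {..<n $ j})"
    by (auto simp: copies_def p_def axis_def split: if_splits)
  have p: "p \<in> copies (n + axis k 1)"
    by (auto simp: copies_def p_def axis_def)
  have del: "Haf (copies (n + axis k 1) - {p, (j, a)}) ?B = Haf_rep A (n - axis j 1)"
    if a: "a < n $ j" for j a
  proof -
    \<comment> \<open>The map \<open>g\<close> leaves room for the deleted copy \<open>a\<close> of
      \<open>j\<close>: copies numbered \<open>a\<close> or higher move up by one.\<close>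
    define g where "g = (\<lambda>(i, b). (i, if i = j \<and> a \<le> b then Suc b else b))"
    have "copies (n + axis k 1) - {p, (j, a)} = (SIGMA j:UNIV. {..<n $ j}) - {(j, a)}"
      using rest by blast
    also have "\<dots> = g ` copies (n - axis j 1)"
    proof
      show "(SIGMA j:UNIV. {..<n $ j}) - {(j, a)} \<subseteq> g ` copies (n - axis j 1)"
      proof
        fix x assume "x \<in> (SIGMA j:UNIV. {..<n $ j}) - {(j, a)}"
        then obtain i b where x: "x = (i, b)" and b: "b < n $ i" "i = j \<longrightarrow> b \<noteq> a"
          by blast
        have "(i, b) = g (i, if i = j \<and> a < b then b - 1 else b)"
          using b by (auto simp: g_def)
        moreover have "(i, if i = j \<and> a < b then b - 1 else b) \<in> copies (n - axis j 1)"
          using b a by (auto simp: copies_def axis_def)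
        ultimately show "x \<in> g ` copies (n - axis j 1)"
          unfolding x by (rule image_eqI)
      qed
      show "g ` copies (n - axis j 1) \<subseteq> (SIGMA j:UNIV. {..<n $ j}) - {(j, a)}"
        by (auto simp: g_def copies_def axis_def split: if_splits)
    qed
    finally have "bij_betw g (copies (n - axis j 1)) (copies (n + axis k 1) - {p, (j, a)})"
      by (auto simp: bij_betw_def inj_on_def g_def split: if_splits)
    then show ?thesis
      unfolding Haf_rep_def
      by (rule Haf_reindex[OF finite_copies _ B B]) (auto simp: g_def repeated_def)
  qed
  have "Haf_rep A (n + axis k 1)
      = (\<Sum>(j, a)\<in>(SIGMA j:UNIV. {..<n $ j}). ?B p (j, a) * Haf (copies (n + axis k 1) - {p, (j, a)}) ?B)"
    unfolding Haf_rep_def Haf_expand[OF B finite_copies p] rest by (simp add: case_prod_unfold)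
  also have "\<dots> = (\<Sum>(j, a)\<in>(SIGMA j:UNIV. {..<n $ j}). A $ k $ j * Haf_rep A (n - axis j 1))"
    using del by (intro sum.cong refl) (auto simp: repeated_def p_def)
  also have "\<dots> = (\<Sum>j\<in>UNIV. \<Sum>a<n $ j. A $ k $ j * Haf_rep A (n - axis j 1))"
    by (rule sum.Sigma[symmetric]) auto
  finally show ?thesis
    by (simp add: mult_ac)
qed

section \<open>Norm bound and summability\<close>

lemma inner_complex_vec: "inner x y = Re (\<Sum>i\<in>UNIV. cnj (x $ i) * y $ i)"
  for x y :: "complex ^ 'n"
  by (simp add: inner_vec_def inner_complex_def Re_sum)

lemma inner_adjoint:
  fixes M :: "complex ^ 'n ^ 'm"
  shows "inner (M *v x) y = inner x (map_matrix cnj (transpose M) *v y)"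
proof -
  have "(\<Sum>i\<in>UNIV. cnj ((M *v x) $ i) * y $ i)
      = (\<Sum>i\<in>UNIV. \<Sum>j\<in>UNIV. cnj (M $ i $ j) * cnj (x $ j) * y $ i)"
    by (simp add: matrix_vector_mult_def sum_distrib_right)
  also have "\<dots> = (\<Sum>j\<in>UNIV. \<Sum>i\<in>UNIV. cnj (x $ j) * (cnj (M $ i $ j) * y $ i))"
    by (subst sum.swap) (simp add: mult_ac)
  also have "\<dots> = (\<Sum>j\<in>UNIV. cnj (x $ j) * (map_matrix cnj (transpose M) *v y) $ j)"
    by (simp add: matrix_vector_mult_def transpose_def map_matrix_def sum_distrib_left)
  finally show ?thesis
    by (simp add: inner_complex_vec)
qed

lemma matrix_vector_scaleR:
  fixes M :: "complex ^ 'n ^ 'm"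
  shows "M *v (t *\<^sub>R x) = t *\<^sub>R (M *v x)"
  by (simp add: vec_eq_iff matrix_vector_mult_def scaleR_sum_right)

lemma norm_add_scaleR_square:
  fixes x y :: "'a :: real_inner"
  shows "(norm (x + t *\<^sub>R y))\<^sup>2 = (norm x)\<^sup>2 + 2 * t * inner x y + t\<^sup>2 * (norm y)\<^sup>2"
  unfolding power2_norm_eq_inner
  by (simp add: inner_add_left inner_add_right inner_commute[of y x] power2_eq_square distrib_left)

lemma linear_coeff_zero:
  fixes b q :: real
  assumes "\<And>t. 2 * t * b + t\<^sup>2 * q \<ge> 0" "q \<ge> 0"
  shows "b = 0"
proof (rule ccontr)
  assume "b \<noteq> 0"
  \<comment> \<open>For \<open>q > 0\<close> the quadratic is smallest at \<open>- b / q\<close>;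
    the denominator \<open>q + 1\<close> also covers \<open>q = 0\<close>, and the value is still
    negative.\<close>
  have "2 * (- b / (q + 1)) * b + (- b / (q + 1))\<^sup>2 * q = - (b\<^sup>2 * (q + 2) / (q + 1)\<^sup>2)"
    using assms(2) by (simp add: divide_simps power2_eq_square) (simp add: algebra_simps)
  moreover have "b\<^sup>2 * (q + 2) / (q + 1)\<^sup>2 > 0"
    using \<open>b \<noteq> 0\<close> assms(2) by (intro divide_pos_pos mult_pos_pos) auto
  ultimately show False
    using assms(1)[of "- b / (q + 1)"] by linarith
qed

text \<open>
  The maximum of \<open>norm (B *v v)\<close> over the unit sphere is attained at an eigenvector of \<open>B\<^sup>* B\<close>, because
  the nonnegative form \<open>\<sigma>\<^sup>2 (norm v)\<^sup>2 - (norm (B *v v))\<^sup>2\<close> vanishes there to second order.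
\<close>

lemma norm_bound_from_singular_values:
  fixes B :: "complex ^ 'n ^ 'n"
  assumes "\<And>s. singular_value B s \<Longrightarrow> s < 1"
  obtains \<sigma> where "0 \<le> \<sigma>" "\<sigma> < 1" "\<And>v. norm (B *v v) \<le> \<sigma> * norm v"
proof -
  let ?H = "map_matrix cnj (transpose B) ** B"
  have "linear ((*v) B)"
    by (rule linearI) (simp_all add: matrix_vector_right_distrib matrix_vector_scaleR)
  then have "bounded_linear ((*v) B)"
    by (rule linear_conv_bounded_linear[THEN iffD1])
  then have "continuous_on (sphere 0 1) (\<lambda>v. norm (B *v v))"
    by (rule continuous_on_norm[OF linear_continuous_on])
  moreover have "axis undefined 1 \<in> sphere (0 :: complex ^ 'n) 1"
    by (simp add: norm_axis_1)
  then have "sphere (0 :: complex ^ 'n) 1 \<noteq> {}"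
    by blast
  ultimately obtain v0 where v0: "norm v0 = 1"
    and max: "\<And>v. norm v = 1 \<Longrightarrow> norm (B *v v) \<le> norm (B *v v0)"
    using continuous_attains_sup[OF compact_sphere, of 0 1 "\<lambda>v. norm (B *v v)"]
    by (metis mem_sphere_0)
  define \<sigma> where "\<sigma> = norm (B *v v0)"
  have bound: "norm (B *v v) \<le> \<sigma> * norm v" for v
  proof (cases "v = 0")
    case False
    have "norm (B *v (inverse (norm v) *\<^sub>R v)) \<le> \<sigma>"
      unfolding \<sigma>_def using False by (intro max) simp
    then show ?thesis
      using False by (simp add: matrix_vector_scaleR field_simps)
  qed simp
  define q where "q v = \<sigma>\<^sup>2 * (norm v)\<^sup>2 - (norm (B *v v))\<^sup>2" for v
  have q: "q v \<ge> 0" for v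
    using power_mono[OF bound norm_ge_zero, of v 2] by (simp add: q_def power_mult_distrib)
  have "inner (\<sigma>\<^sup>2 *\<^sub>R v0 - ?H *v v0) u = 0" for u
  proof (rule linear_coeff_zero)
    show "q u \<ge> 0" by (rule q)
    have adj: "inner (B *v v0) (B *v u) = inner (?H *v v0) u"
      using inner_adjoint[of B u "B *v v0"] by (simp only: matrix_vector_mul_assoc inner_commute)
    fix t
    have "q (v0 + t *\<^sub>R u) = q v0 + 2 * t * inner (\<sigma>\<^sup>2 *\<^sub>R v0 - ?H *v v0) u + t\<^sup>2 * q u"
      unfolding q_def matrix_vector_right_distrib matrix_vector_scaleR norm_add_scaleR_square inner_diff_left adj[symmetric]
      by (simp add: algebra_simps)
    moreover have "q v0 = 0"
      by (simp add: q_def \<sigma>_def v0)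
    ultimately show "0 \<le> 2 * t * inner (\<sigma>\<^sup>2 *\<^sub>R v0 - ?H *v v0) u + t\<^sup>2 * q u"
      using q[of "v0 + t *\<^sub>R u"] by simp
  qed
  then have "\<sigma>\<^sup>2 *\<^sub>R v0 - ?H *v v0 = 0"
    by (rule inner_eq_zero_iff[THEN iffD1])
  then have "?H *v v0 = of_real (\<sigma>\<^sup>2) *s v0"
    by (simp add: vec_eq_iff vector_scalar_mult_def) (simp add: scaleR_conv_of_real)
  moreover have "v0 \<noteq> 0" "\<sigma> \<ge> 0"
    using v0 by (auto simp: \<sigma>_def)
  ultimately have "singular_value B \<sigma>"
    unfolding singular_value_def by (intro conjI exI[of _ v0])
  then have "\<sigma> < 1"
    by (rule assms)
  with \<open>\<sigma> \<ge> 0\<close> show ?thesis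
    using bound by (rule that)
qed

section \<open>Multi-indices graded by total photon number\<close>

definition unit :: "'m \<Rightarrow> nat ^ 'm" where
  "unit k = axis k 1"

lemma unit_nth [simp]: "unit k $ i = (if i = k then 1 else 0)"
  by (simp add: unit_def axis_def)

definition total :: "nat ^ 'm \<Rightarrow> nat" where
  "total n = (\<Sum>i\<in>UNIV. n $ i)"

definition level :: "nat \<Rightarrow> (nat ^ 'm) set" where
  "level N = {n. total n = N}"

lemma finite_level: "finite (level N :: (nat ^ 'm) set)"
proof -
  have "finite {f :: 'm \<Rightarrow> nat. \<forall>i. (i \<in> UNIV \<longrightarrow> f i \<in> {..N}) \<and> (i \<notin> UNIV \<longrightarrow> f i = 0)}"
    by (rule finite_set_of_finite_funs) auto
  then have "finite (vec_lambda ` {f :: 'm \<Rightarrow> nat. \<forall>i. f i \<le> N})"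
    by simp
  moreover have "level N \<subseteq> vec_lambda ` {f :: 'm \<Rightarrow> nat. \<forall>i. f i \<le> N}"
  proof
    fix n :: "nat ^ 'm" assume "n \<in> level N"
    then have "n $ i \<le> N" for i
      using member_le_sum[of i UNIV "($) n"] by (simp add: level_def total_def)
    then show "n \<in> vec_lambda ` {f. \<forall>i. f i \<le> N}"
      by (intro image_eqI[of _ _ "($) n"]) auto
  qed
  ultimately show ?thesis
    using finite_subset by blast
qed

lemma total_add_unit: "total (n + unit k) = Suc (total n)"
  by (simp add: total_def sum.distrib)

lemma add_diff_unit: 
  fixes n :: "nat ^ 'm" shows "n $ k > 0 \<Longrightarrow> (n - unit k) + unit k = n"
  by (auto simp: vec_eq_iff)

lemma diff_add_unit: 
  fixes n :: "nat ^ 'm" shows "(n + unit k) - unit k = n"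
  by (auto simp: vec_eq_iff)

lemma bij_add_unit: "bij_betw (\<lambda>n. n + unit k) UNIV {n :: nat ^ 'm. n $ k > 0}"
  by (rule bij_betw_byWitness[where f' = "\<lambda>n. n - unit k"])
     (auto simp: add_diff_unit diff_add_unit)

text \<open>Adding \<open>unit k\<close> identifies level \<open>N\<close> with the part of level
  \<open>Suc N\<close> where \<open>n $ k > 0\<close>; \<open>f\<close> vanishes on the
  rest.\<close>

lemma sum_level_Suc:
  fixes f :: "nat ^ 'm \<Rightarrow> 'b :: comm_monoid_add"
  assumes "\<And>n. n $ k = 0 \<Longrightarrow> f n = 0"
  shows "sum f (level (Suc N)) = (\<Sum>n\<in>level N. f (n + unit k))"
proof -
  have "sum f (level (Suc N)) = sum f {n \<in> level (Suc N). n $ k > 0}"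
    using assms finite_level by (intro sum.mono_neutral_right) auto
  also have "bij_betw (\<lambda>n. n + unit k) (level N) {n \<in> level (Suc N). n $ k > 0}"
  proof (rule bij_betw_byWitness[where f' = "\<lambda>n. n - unit k"])
    show "(\<lambda>n. n - unit k) ` {n \<in> level (Suc N). n $ k > 0} \<subseteq> level N"
    proof clarify
      fix n :: "nat ^ 'm" assume "n \<in> level (Suc N)" "n $ k > 0"
      then show "n - unit k \<in> level N"
        using total_add_unit[of "n - unit k" k] by (simp add: add_diff_unit level_def)
    qed
  qed (auto simp: add_diff_unit diff_add_unit level_def total_add_unit)
  then have "sum f {n \<in> level (Suc N). n $ k > 0} = (\<Sum>n\<in>level N. f (n + unit k))"
    by (rule sum.reindex_bij_betw[symmetric])
  finally show ?thesis .
qed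

lemma has_sum_shift:
  fixes f :: "nat ^ 'm \<Rightarrow> 'b :: {comm_monoid_add, topological_space}"
  assumes "\<And>n. n $ k = 0 \<Longrightarrow> f n = 0"
  shows "(f has_sum s) UNIV \<longleftrightarrow> ((\<lambda>n. f (n + unit k)) has_sum s) UNIV"
proof -
  have "(f has_sum s) UNIV \<longleftrightarrow> (f has_sum s) {n. n $ k > 0}"
    using assms by (intro has_sum_cong_neutral) auto
  then show ?thesis
    by (simp add: has_sum_reindex_bij_betw[OF bij_add_unit])
qed

text \<open>A finite set of multi-indices meets only finitely many levels, so nonnegativity bounds
  its sum by \<open>s\<close> and gives summability. Regrouping along \<open>total\<close> then
  identifies the value.\<close>

lemma has_sum_from_levels:
  fixes f :: "nat ^ 'm \<Rightarrow> real"
  assumes nonneg: "\<And>n. f n \<ge> 0" and sums: "(\<lambda>N. sum f (level N)) sums s"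
  shows "(f has_sum s) UNIV"
proof -
  have nn: "sum f (level N) \<ge> 0" for N
    using nonneg by (intro sum_nonneg) auto
  have "f summable_on UNIV"
  proof (rule nonneg_bdd_above_summable_on)
    have "sum f F \<le> s" if "finite F" for F
    proof -
      \<comment> \<open>All totals occurring in \<open>F\<close> lie below \<open>K\<close>;
        inserting 0 keeps \<open>Max\<close> meaningful for empty \<open>F\<close>.\<close>
      define K where "K = Suc (Max (insert 0 (total ` F)))"
      have "F \<subseteq> (\<Union>N<K. level N)"
        using that by (auto simp: K_def level_def less_Suc_eq_le intro!: Max_ge)
      then have "sum f F \<le> sum f (\<Union>N<K. level N)"
        using nonneg by (intro sum_mono2) (auto simp: finite_level)
      also have "\<dots> = (\<Sum>N<K. sum f (level N))"
        by (intro sum.UNION_disjoint ballI finite_level) (auto simp: level_def)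
      also have "\<dots> \<le> s"
        using sums nn by (intro sum_le_suminf[of "\<lambda>N. sum f (level N)", THEN order_trans])
          (auto simp: sums_iff)
      finally show ?thesis .
    qed
    then show "bdd_above (sum f ` {F. F \<subseteq> UNIV \<and> finite F})"
      by (intro bdd_aboveI2[of _ _ s]) auto
  qed (use nonneg in auto)
  then obtain s' where s': "(f has_sum s') UNIV"
    by (auto simp: summable_on_def)
  have "bij_betw snd (Sigma UNIV (level :: _ \<Rightarrow> (nat ^ 'm) set)) UNIV"
    by (rule bij_betw_byWitness[where f' = "\<lambda>n. (total n, n)"]) (auto simp: level_def)
  then have "((\<lambda>x. f (snd x)) has_sum s') (Sigma UNIV level)"
    using s' has_sum_reindex_bij_betw by blast
  then have "((\<lambda>N. sum f (level N)) has_sum s') UNIV"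
    by (rule has_sum_SigmaD) (simp add: finite_level has_sum_finite)
  then have "(\<lambda>N. sum f (level N)) sums s'"
    by (rule has_sum_imp_sums)
  with sums s' show ?thesis
    using sums_unique2 by blast
qed

section \<open>Ladder operators and decay of the level weights\<close>

definition annihilate :: "'m \<Rightarrow> (nat ^ 'm \<Rightarrow> complex) \<Rightarrow> nat ^ 'm \<Rightarrow> complex" where
  "annihilate k c n = complex_of_real (sqrt (real (n $ k) + 1)) * c (n + unit k)"

text \<open>
  Where \<open>n - unit k\<close> is truncated, that is for \<open>n $ k = 0\<close>, the square root vanishes.
\<close>

definition create :: "'m \<Rightarrow> (nat ^ 'm \<Rightarrow> complex) \<Rightarrow> nat ^ 'm \<Rightarrow> complex" where
  "create k c n = complex_of_real (sqrt (real (n $ k))) * c (n - unit k)"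

text \<open>For symmetric \<open>B\<close> this equation characterises, up to a scalar, the state
  obtained by applying the exponential of half the quadratic form \<open>B\<close> in the creation
  operators to the vacuum.\<close>

definition squeezed :: "complex ^ 'm ^ 'm \<Rightarrow> (nat ^ 'm \<Rightarrow> complex) \<Rightarrow> bool" where
  "squeezed B c \<longleftrightarrow> (\<forall>k n. annihilate k c n = (\<Sum>j\<in>UNIV. B $ k $ j * create j c n))"

text \<open>Photon counting turns the weight of level \<open>N + 2\<close> into the squared norm of
  the annihilated amplitudes on level \<open>N + 1\<close>. The bound on \<open>B\<close> passes to
  the created amplitudes there, whose squared norm lives on level \<open>N\<close> with the factor
  \<open>N + CARD('m)\<close>, one extra photon per mode.\<close>

lemma level_recursion:
  fixes B :: "complex ^ 'm ^ 'm"
  assumes "squeezed B c" "\<And>v. norm (B *v v) \<le> \<sigma> * norm v"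
  shows "real (N + 2) * (\<Sum>n\<in>level (N + 2). (cmod (c n))\<^sup>2)
      \<le> \<sigma>\<^sup>2 * real (N + CARD('m)) * (\<Sum>n\<in>level N. (cmod (c n))\<^sup>2)"
proof -
  have nv: "(norm v)\<^sup>2 = (\<Sum>i\<in>UNIV. (cmod (v $ i))\<^sup>2)" for v :: "complex ^ 'm"
    by (simp add: norm_vec_def L2_set_def sum_nonneg)
  have "real (N + 2) * (\<Sum>n\<in>level (N + 2). (cmod (c n))\<^sup>2)
      = (\<Sum>n\<in>level (N + 2). real (total n) * (cmod (c n))\<^sup>2)"
    by (simp add: level_def sum_distrib_left)
  also have "\<dots> = (\<Sum>k\<in>UNIV. \<Sum>n\<in>level (Suc (Suc N)). real (n $ k) * (cmod (c n))\<^sup>2)"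
    by (subst sum.swap) (simp add: total_def sum_distrib_right)
  also have "\<dots> = (\<Sum>k\<in>UNIV. \<Sum>n\<in>level (Suc N). (cmod (annihilate k c n))\<^sup>2)"
    by (rule sum.cong[OF refl], subst sum_level_Suc)
       (auto simp: annihilate_def norm_mult power_mult_distrib algebra_simps)
  also have "\<dots> = (\<Sum>n\<in>level (Suc N). (norm (B *v (\<chi> j. create j c n)))\<^sup>2)"
    using assms(1) by (subst sum.swap) (simp add: nv squeezed_def matrix_vector_mult_def)
  also have "\<dots> \<le> (\<Sum>n\<in>level (Suc N). \<sigma>\<^sup>2 * (norm (\<chi> j. create j c n))\<^sup>2)"
    using power_mono[OF assms(2) norm_ge_zero, where n = 2]
    by (intro sum_mono) (simp add: power_mult_distrib)
  also have "\<dots> = \<sigma>\<^sup>2 * (\<Sum>j\<in>UNIV. \<Sum>n\<in>level (Suc N). (cmod (create j c n))\<^sup>2)"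
    by (subst sum.swap) (simp add: nv sum_distrib_left)
  also have "(\<Sum>j\<in>UNIV. \<Sum>n\<in>level (Suc N). (cmod (create j c n))\<^sup>2)
      = (\<Sum>j\<in>UNIV. \<Sum>n\<in>level N. (real (n $ j) + 1) * (cmod (c n))\<^sup>2)"
    by (rule sum.cong[OF refl], subst sum_level_Suc)
       (auto simp: create_def norm_mult power_mult_distrib diff_add_unit)
  also have "\<dots> = (\<Sum>n\<in>level N. (real (total n) + CARD('m)) * (cmod (c n))\<^sup>2)"
    by (subst sum.swap) (simp add: total_def sum.distrib flip: sum_distrib_right)
  also have "\<dots> = real (N + CARD('m)) * (\<Sum>n\<in>level N. (cmod (c n))\<^sup>2)"
    by (simp add: level_def sum_distrib_left)
  finally show ?thesis
    by (simp add: mult.assoc)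
qed

text \<open>The combination \<open>u (Suc n) + sqrt r * u n\<close> turns the two-step bound into a
  one-step contraction by \<open>sqrt r\<close>.\<close>

lemma summable_two_step:
  fixes u :: "nat \<Rightarrow> real"
  assumes nonneg: "\<And>n. u n \<ge> 0" and r: "0 < r" "r < 1"
    and step: "\<And>n. n \<ge> K \<Longrightarrow> u (n + 2) \<le> r * u n"
  shows "summable u"
proof -
  define v where "v n = u (Suc n) + sqrt r * u n" for n
  have "summable v"
  proof (rule summable_ratio_test)
    show "sqrt r < 1" using r by simp
    fix n assume "n \<ge> K"
    have "v (Suc n) \<le> sqrt r * v n"
      using step[OF \<open>n \<ge> K\<close>] r by (simp add: v_def distrib_left flip: mult.assoc)
    then show "norm (v (Suc n)) \<le> sqrt r * norm (v n)"
      using nonneg r by (simp add: v_def)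
  qed
  then have "summable (\<lambda>n. sqrt r * u n)"
    by (rule summable_comparison_test') (use nonneg r in \<open>auto simp: v_def\<close>)
  then show ?thesis
    using r by (simp add: summable_cmult_iff)
qed

text \<open>The ratio bound between levels \<open>N + 2\<close> and \<open>N\<close> tends to the
  square of \<open>\<sigma>\<close>, which leaves room for some \<open>\<rho> > 1\<close>. A radius
  of convergence beyond 1 yields finite photon moments and permits differentiation of the level
  series up to \<open>t = 1\<close>.\<close>

lemma level_weights_summable:
  fixes B :: "complex ^ 'm ^ 'm"
  assumes "squeezed B c" "\<And>s. singular_value B s \<Longrightarrow> s < 1"
  obtains \<rho> :: real where "\<rho> > 1" "summable (\<lambda>N. (\<Sum>n\<in>level N. (cmod (c n))\<^sup>2) * \<rho> ^ N)"
proof -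
  obtain \<sigma> where \<sigma>: "0 \<le> \<sigma>" "\<sigma> < 1" "\<And>v. norm (B *v v) \<le> \<sigma> * norm v"
    using norm_bound_from_singular_values assms(2) by blast
  \<comment> \<open>The reciprocal of the midpoint between \<open>\<sigma>\<close> and 1, so that
    both \<open>\<rho> > 1\<close> and \<open>\<sigma> * \<rho> < 1\<close>.\<close>
  define \<rho> where "\<rho> = 2 / (1 + \<sigma>)"
  define a where "a = (\<sigma> * \<rho>)\<^sup>2"
  \<comment> \<open>The gap between \<open>a\<close> and \<open>r\<close> absorbs the factor
    \<open>(N + CARD('m)) / (N + 2)\<close> for large \<open>N\<close>.\<close>
  define r where "r = (1 + a) / 2"
  have "\<rho> > 1" and "\<sigma> * \<rho> < 1" and "\<sigma> * \<rho> \<ge> 0"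
    using \<sigma> by (auto simp: \<rho>_def field_simps)
  then have a: "0 \<le> a" "a < 1"
    by (auto simp: a_def power_less_one_iff abs_square_less_1)
  then have r: "a < r" "r < 1" "0 < r"
    by (auto simp: r_def)
  define s where "s N = (\<Sum>n\<in>level N. (cmod (c n))\<^sup>2)" for N
  have s: "s N \<ge> 0" for N
    by (simp add: s_def sum_nonneg)
  \<comment> \<open>From \<open>K\<close> on, \<open>a * CARD('m)\<close> is at most
    \<open>(r - a) * N\<close>.\<close>
  define K where "K = nat \<lceil>a * real CARD('m) / (r - a)\<rceil>"
  have "summable (\<lambda>N. s N * \<rho> ^ N)"
  proof (rule summable_two_step[OF _ r(3,2)])
    show "s N * \<rho> ^ N \<ge> 0" for N
      using s \<open>\<rho> > 1\<close> by simp
    fix N assume "N \<ge> K"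
    then have "a * real CARD('m) / (r - a) \<le> real N"
      unfolding K_def by linarith
    then have "a * (real N + real CARD('m)) \<le> r * (real N + 2)"
      using r by (simp add: field_simps)
    moreover have "real (N + 2) * s (N + 2) \<le> \<sigma>\<^sup>2 * real (N + CARD('m)) * s N"
      unfolding s_def by (rule level_recursion[OF assms(1) \<sigma>(3)])
    ultimately have "real (N + 2) * (s (N + 2) * \<rho>\<^sup>2) \<le> real (N + 2) * (r * s N)"
    proof -
      have "real (N + 2) * (s (N + 2) * \<rho>\<^sup>2) \<le> (\<sigma>\<^sup>2 * real (N + CARD('m)) * s N) * \<rho>\<^sup>2"
        using \<open>real (N + 2) * s (N + 2) \<le> _\<close> by (simp add: mult_right_mono flip: mult.assoc)
      also have "\<dots> = a * (real N + real CARD('m)) * s N"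
        by (simp add: a_def power_mult_distrib)
      also have "\<dots> \<le> r * (real N + 2) * s N"
        using \<open>a * (real N + real CARD('m)) \<le> _\<close> s by (intro mult_right_mono)
      finally show ?thesis
        by (simp only: mult_ac of_nat_add of_nat_numeral)
    qed
    then have "s (N + 2) * \<rho>\<^sup>2 \<le> r * s N"
      by (rule mult_le_cancel_left_pos[THEN iffD1, rotated]) simp
    then have "(s (N + 2) * \<rho>\<^sup>2) * \<rho> ^ N \<le> (r * s N) * \<rho> ^ N"
      using \<open>\<rho> > 1\<close> by (intro mult_right_mono) auto
    then show "s (N + 2) * \<rho> ^ (N + 2) \<le> r * (s N * \<rho> ^ N)"
      by (simp add: power_add mult_ac power2_eq_square)
  qed
  then show ?thesis
    using that \<open>\<rho> > 1\<close> by (simp add: s_def)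
qed

section \<open>Moments of squeezed states\<close>

definition square_summable :: "(nat ^ 'm \<Rightarrow> complex) \<Rightarrow> bool" where
  "square_summable f \<longleftrightarrow> (\<lambda>n. (cmod (f n))\<^sup>2) summable_on UNIV"

definition fock_inner :: "(nat ^ 'm \<Rightarrow> complex) \<Rightarrow> (nat ^ 'm \<Rightarrow> complex) \<Rightarrow> complex" where
  "fock_inner f g = (\<Sum>\<^sub>\<infinity>n. cnj (f n) * g n)"

lemma fock_inner_summable:
  assumes "square_summable f" "square_summable g"
  shows "(\<lambda>n. cnj (f n) * g n) summable_on UNIV"
  unfolding summable_on_iff_abs_summable_on_complex
proof (rule Infinite_Sum.abs_summable_on_comparison_test')
  show "(\<lambda>n. (cmod (f n))\<^sup>2 + (cmod (g n))\<^sup>2) summable_on UNIV"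
    using assms by (auto simp: square_summable_def intro: summable_on_add)
  fix n
  have "0 \<le> (cmod (f n) - cmod (g n))\<^sup>2" "0 \<le> (cmod (f n))\<^sup>2 + (cmod (g n))\<^sup>2"
    by auto
  then show "norm (cnj (f n) * g n) \<le> (cmod (f n))\<^sup>2 + (cmod (g n))\<^sup>2"
    unfolding norm_mult complex_mod_cnj power2_diff by linarith
qed

lemma fock_inner_cnj: "cnj (fock_inner f g) = fock_inner g f"
  by (simp add: fock_inner_def mult.commute flip: infsum_cnj)

lemma fock_inner_self:
  assumes "square_summable f"
  shows "fock_inner f f = of_real (\<Sum>\<^sub>\<infinity>n. (cmod (f n))\<^sup>2)"
proof -
  have "((\<lambda>n. complex_of_real ((cmod (f n))\<^sup>2)) has_sum of_real (\<Sum>\<^sub>\<infinity>n. (cmod (f n))\<^sup>2)) UNIV"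
    using assms by (intro has_sum_of_real has_sum_infsum) (simp add: square_summable_def)
  moreover have "complex_of_real ((cmod (f n))\<^sup>2) = cnj (f n) * f n" for n
    by (simp add: complex_norm_square mult.commute del: of_real_power)
  ultimately show ?thesis
    unfolding fock_inner_def by (auto intro: infsumI)
qed

lemma has_sum_finite_sum:
  fixes f :: "'i \<Rightarrow> 'a \<Rightarrow> 'b :: topological_comm_monoid_add"
  assumes "\<And>j. j \<in> J \<Longrightarrow> (f j has_sum s j) A"
  shows "((\<lambda>x. \<Sum>j\<in>J. f j x) has_sum (\<Sum>j\<in>J. s j)) A"
  using assms by (induction J rule: infinite_finite_induct) (auto intro: has_sum_add)

lemma fock_inner_sum_right:
  assumes "square_summable f" "\<And>j. square_summable (g j)"
  shows "fock_inner f (\<lambda>n. \<Sum>j\<in>UNIV. a j * g j n) = (\<Sum>j\<in>(UNIV :: 'i :: finite set). a j * fock_inner f (g j))"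
proof -
  have "fock_inner f (\<lambda>n. \<Sum>j\<in>UNIV. a j * g j n) = (\<Sum>\<^sub>\<infinity>n. \<Sum>j\<in>UNIV. a j * (cnj (f n) * g j n))"
    by (simp add: fock_inner_def sum_distrib_left mult_ac)
  also have "\<dots> = (\<Sum>j\<in>UNIV. \<Sum>\<^sub>\<infinity>n. a j * (cnj (f n) * g j n))"
    using assms by (intro infsumI has_sum_finite_sum has_sum_infsum summable_on_cmult_right fock_inner_summable)
  finally show ?thesis
    by (simp add: fock_inner_def infsum_cmult_right')
qed

lemma infsum_shift:
  fixes f :: "nat ^ 'm \<Rightarrow> 'b :: {comm_monoid_add, t2_space}"
  assumes "\<And>n. n $ k = 0 \<Longrightarrow> f n = 0"
  shows "(\<Sum>\<^sub>\<infinity>n. f n) = (\<Sum>\<^sub>\<infinity>n. f (n + unit k))"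
  by (rule infsum_eqI') (rule has_sum_shift[OF assms])

lemma summable_on_shift:
  fixes f :: "nat ^ 'm \<Rightarrow> 'b :: {comm_monoid_add, topological_space}"
  assumes "\<And>n. n $ k = 0 \<Longrightarrow> f n = 0"
  shows "f summable_on UNIV \<longleftrightarrow> (\<lambda>n. f (n + unit k)) summable_on UNIV"
  using has_sum_shift[of k f, OF assms] by (simp add: summable_on_def)

lemma component_le_total: "n $ k \<le> total n"
  unfolding total_def by (rule member_le_sum) auto

lemma cmod_annihilate:
  "(cmod (annihilate k c n))\<^sup>2 = real ((n + unit k) $ k) * (cmod (c (n + unit k)))\<^sup>2"
  by (simp add: annihilate_def norm_mult power_mult_distrib)

lemma infsum_annihilate:
  "(\<Sum>\<^sub>\<infinity>n. (cmod (annihilate k c n))\<^sup>2) = (\<Sum>\<^sub>\<infinity>n. real (n $ k) * (cmod (c n))\<^sup>2)"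
  unfolding cmod_annihilate by (rule infsum_shift[symmetric]) simp

text \<open>Finite mean total photon number makes the state and all its images under one ladder
  operator square summable, so the pairings of second order converge.\<close>

locale finite_energy =
  fixes c :: "nat ^ 'm \<Rightarrow> complex"
  assumes energy: "(\<lambda>n. (1 + real (total n)) * (cmod (c n))\<^sup>2) summable_on UNIV"
begin

lemma energy_bound:
  assumes "\<And>n. 0 \<le> h n" "\<And>n. h n \<le> 1 + real (total n)"
  shows "(\<lambda>n. h n * (cmod (c n))\<^sup>2) summable_on UNIV"
  by (rule summable_on_comparison_test[OF energy]) (use assms in \<open>auto intro: mult_right_mono\<close>)

lemma number_summable: "(\<lambda>n. real (n $ k) * (cmod (c n))\<^sup>2) summable_on UNIV"
  using component_le_total[of _ k] by (intro energy_bound) (auto simp: add_increasing)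

lemma square_summable_state: "square_summable c"
  using energy_bound[of "\<lambda>_. 1"] by (simp add: square_summable_def)

lemma square_summable_annihilate: "square_summable (annihilate k c)"
  using number_summable[of k] unfolding square_summable_def cmod_annihilate
  by (subst (asm) summable_on_shift[where k = k]) auto

lemma create_norm: "(cmod (create k c (n + unit k)))\<^sup>2 = (real (n $ k) + 1) * (cmod (c n))\<^sup>2"
  by (simp add: create_def norm_mult power_mult_distrib diff_add_unit)

lemma square_summable_create: "square_summable (create k c)"
proof -
  have "(\<lambda>n. (cmod (create k c (n + unit k)))\<^sup>2) summable_on UNIV"
    unfolding create_norm using component_le_total[of _ k] by (intro energy_bound) auto
  then show ?thesis
    unfolding square_summable_def by (subst summable_on_shift[where k = k]) (auto simp: create_def)
qed

lemma annihilate_commute: "annihilate i (annihilate l c) = annihilate l (annihilate i c)"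
  by (cases "i = l") (auto simp: fun_eq_iff annihilate_def add_ac)

text \<open>Creation is adjoint to annihilation. The two sums agree term by term after a shift by
  \<open>unit i\<close>, which settles convergence for the twice annihilated amplitudes as
  well.\<close>

lemma fock_inner_create_annihilate:
  "fock_inner (create i c) (annihilate l c) = (\<Sum>\<^sub>\<infinity>n. cnj (c n) * annihilate i (annihilate l c) n)"
  unfolding fock_inner_def
  by (subst infsum_shift[where k = i])
     (auto simp: create_def annihilate_def[of i "annihilate l c"] diff_add_unit mult_ac intro!: infsum_cong)

lemma fock_inner_create_annihilate_sym:
  "fock_inner (create i c) (annihilate l c) = fock_inner (create l c) (annihilate i c)"
  by (simp add: fock_inner_create_annihilate annihilate_commute)

text \<open>The canonical commutation relation between annihilation and creation operators.\<close>

lemma fock_inner_create_create: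
  "fock_inner (create i c) (create j c)
    = (if i = j then fock_inner c c else 0) + fock_inner (annihilate j c) (annihilate i c)"
proof (cases "i = j")
  case True
  have "(\<Sum>\<^sub>\<infinity>n. (cmod (create j c n))\<^sup>2) = (\<Sum>\<^sub>\<infinity>n. (cmod (c n))\<^sup>2 + real (n $ j) * (cmod (c n))\<^sup>2)"
    by (subst infsum_shift[where k = j]) (simp_all add: create_norm, simp_all add: create_def algebra_simps)
  also have "\<dots> = (\<Sum>\<^sub>\<infinity>n. (cmod (c n))\<^sup>2) + (\<Sum>\<^sub>\<infinity>n. (cmod (annihilate j c n))\<^sup>2)"
    unfolding infsum_annihilate using square_summable_state number_summable
    by (intro infsum_add) (auto simp: square_summable_def)
  finally show ?thesis
    using True by (simp add: fock_inner_self square_summable_state square_summable_annihilate square_summable_create)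
next
  case False
  have comm: "n + unit j + unit i - unit j = n + unit i" for n
    by (metis add.assoc add.commute diff_add_unit)
  \<comment> \<open>Terms with \<open>n $ i = 0\<close> or \<open>n $ j = 0\<close> vanish, so the
    sum may be shifted along both directions.\<close>
  have "fock_inner (create i c) (create j c)
      = (\<Sum>\<^sub>\<infinity>n. cnj (create i c (n + unit j + unit i)) * create j c (n + unit j + unit i))"
    unfolding fock_inner_def using False
    by (subst infsum_shift[where k = i], simp add: create_def, subst infsum_shift[where k = j])
       (auto simp: create_def)
  also have "\<dots> = fock_inner (annihilate j c) (annihilate i c)"
    unfolding fock_inner_def using False
    by (intro infsum_cong) (auto simp: create_def annihilate_def diff_add_unit comm add.commute[of 1])
  finally show ?thesis
    using False by simp
qed

end

text \<open>For \<open>B = A_W A w\<close> this is \<open>X_mat ** calA_W A w\<close>. Keeping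
  \<open>B\<close> general allows the matrix to be scaled along a ray.\<close>

definition coupling :: "complex ^ 'm ^ 'm \<Rightarrow> complex ^ ('m + 'm) ^ ('m + 'm)" where
  "coupling B = block 0 (map_matrix cnj B) B 0"

lemma sum_UNIV_Plus:
  "(\<Sum>p\<in>UNIV. f p) = (\<Sum>i\<in>UNIV. f (Inl i)) + (\<Sum>i\<in>UNIV. f (Inr i))"
  for f :: "'a :: finite + 'b :: finite \<Rightarrow> 'c :: comm_monoid_add"
  unfolding UNIV_Plus_UNIV[symmetric] by (simp add: sum.Plus o_def del: UNIV_Plus_UNIV)

lemma matrix_mult_diff_left: "M ** (N - K) = M ** N - M ** K"
  for N K :: "'a :: ring_1 ^ 'n ^ 'm"
  by (simp add: vec_eq_iff matrix_matrix_mult_def right_diff_distrib sum_subtractf)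

lemma matrix_mult_diff_right: "(M - N) ** K = M ** K - N ** K"
  for M N :: "'a :: ring_1 ^ 'n ^ 'm"
  by (simp add: vec_eq_iff matrix_matrix_mult_def left_diff_distrib sum_subtractf)

lemma invertible_matrix_inv:
  fixes M :: "'a :: field ^ 'n ^ 'n"
  assumes "invertible M"
  shows "M ** matrix_inv M = mat 1" "matrix_inv M ** M = mat 1"
  using assms unfolding invertible_def matrix_inv_def by (rule someI2_ex, blast)+

lemma matrix_inv_unique:
  fixes M N :: "'a :: field ^ 'n ^ 'n"
  assumes "M ** N = mat 1"
  shows "invertible M" "matrix_inv M = N"
proof -
  have NM: "N ** M = mat 1"
    using assms matrix_left_right_inverse by blast
  then show "invertible M"
    using assms by (auto simp: invertible_def)
  then have "M ** matrix_inv M = mat 1"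
    by (rule invertible_matrix_inv)
  then have "N ** (M ** matrix_inv M) = N"
    by simp
  then show "matrix_inv M = N"
    by (simp add: matrix_mul_assoc NM)
qed

text \<open>
  The second moments of a squeezed state, arranged in a block matrix, form a scalar multiple of the inverse
  of \<open>mat 1 - coupling B\<close>: the four block equations are the relation defining squeezed states, the commutation
  relation, and their conjugates.
\<close>

lemma squeezed_moments:
  fixes B :: "complex ^ 'm ^ 'm"
  assumes sq: "squeezed B c" and "finite_energy c" and c0: "c 0 \<noteq> 0"
  shows "invertible (mat 1 - coupling B)"
    and "matrix_inv (mat 1 - coupling B) $ Inl k $ Inl k
      = of_real (1 + (\<Sum>\<^sub>\<infinity>n. real (n $ k) * (cmod (c n))\<^sup>2) / (\<Sum>\<^sub>\<infinity>n. (cmod (c n))\<^sup>2))"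
    and "matrix_inv (mat 1 - coupling B) $ Inr k $ Inr k
      = of_real (1 + (\<Sum>\<^sub>\<infinity>n. real (n $ k) * (cmod (c n))\<^sup>2) / (\<Sum>\<^sub>\<infinity>n. (cmod (c n))\<^sup>2))"
proof -
  interpret finite_energy c by fact
  \<comment> \<open>Here \<open>T\<close> collects the moments of one creation and one annihilation
    operator, and \<open>U\<close> the anomalous moments of two annihilation operators.\<close>
  define T where "T k l = fock_inner (annihilate k c) (annihilate l c)" for k l
  define U where "U k l = fock_inner (create k c) (annihilate l c)" for k l
  define S where "S = (\<Sum>\<^sub>\<infinity>n. (cmod (c n))\<^sup>2)"
  have ann: "annihilate k c = (\<lambda>n. \<Sum>j\<in>UNIV. B $ k $ j * create j c n)" for k
    using sq by (auto simp: squeezed_def fun_eq_iff)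
  have S: "fock_inner c c = of_real S"
    by (simp add: S_def fock_inner_self square_summable_state)
  have "(cmod (c 0))\<^sup>2 \<le> S"
    using infsum_mono2[of "\<lambda>n. (cmod (c n))\<^sup>2" "{0}" UNIV] square_summable_state
    by (simp add: S_def square_summable_def)
  then have "S \<noteq> 0"
    using c0 by (smt (verit) norm_eq_zero zero_less_power2)
  have U: "U k l = (\<Sum>j\<in>UNIV. B $ k $ j * ((if j = l then of_real S else 0) + T j l))" for k l
  proof -
    \<comment> \<open>Commuting the annihilators brings index \<open>k\<close> to the second, linear
      slot, where the squeezing relation can be substituted.\<close>
    have "U k l = fock_inner (create l c) (annihilate k c)"
      unfolding U_def by (rule fock_inner_create_annihilate_sym)
    also have "\<dots> = (\<Sum>j\<in>UNIV. B $ k $ j * fock_inner (create l c) (create j c))"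
      unfolding ann by (intro fock_inner_sum_right square_summable_create)
    finally show ?thesis
      unfolding fock_inner_create_create S by (simp add: T_def eq_commute[of l])
  qed
  have T: "T k l = (\<Sum>i\<in>UNIV. cnj (B $ k $ i) * U i l)" for k l
  proof -
    \<comment> \<open>Conjugation moves \<open>annihilate k c\<close> into the linear slot before
      the squeezing relation is inserted.\<close>
    have "cnj (T k l) = fock_inner (annihilate l c) (\<lambda>n. \<Sum>j\<in>UNIV. B $ k $ j * create j c n)"
      unfolding T_def fock_inner_cnj ann[of k] ..
    also have "\<dots> = (\<Sum>i\<in>UNIV. B $ k $ i * cnj (U i l))"
      unfolding U_def fock_inner_cnj
      by (intro fock_inner_sum_right square_summable_create square_summable_annihilate)
    finally have "cnj (cnj (T k l)) = cnj (\<Sum>i\<in>UNIV. B $ k $ i * cnj (U i l))"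
      by simp
    then show ?thesis
      by simp
  qed
  \<comment> \<open>The candidate inverse: normalised second moments, with the identity in the
    diagonal blocks coming from the commutation relation.\<close>
  define G where "G = block (\<chi> k l. (if k = l then 1 else 0) + T k l / of_real S) (\<chi> k l. cnj (U k l) / of_real S)
    (\<chi> k l. U k l / of_real S) (\<chi> k l. (if k = l then 1 else 0) + cnj (T k l) / of_real S)"
  let ?M = "mat 1 - coupling B"
  have split: "(?M ** G) $ p $ q = G $ p $ q - (\<Sum>r\<in>UNIV. coupling B $ p $ r * G $ r $ q)" for p q
    by (simp add: matrix_mult_diff_right matrix_matrix_mult_def[of "coupling B"])
  \<comment> \<open>\<open>T'\<close> and \<open>U'\<close> are the block equations for the left
    column of \<open>G\<close>; their conjugates \<open>T''\<close> and \<open>U''\<close> serve the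
    right column.\<close>
  have T': "(\<Sum>i\<in>UNIV. cnj (B $ k $ i) * U i l / of_real S) = T k l / of_real S" for k l
    by (simp add: T sum_divide_distrib)
  have U': "(\<Sum>j\<in>UNIV. B $ k $ j * ((if j = l then 1 else 0) + T j l / of_real S)) = U k l / of_real S" for k l
    unfolding U sum_divide_distrib using \<open>S \<noteq> 0\<close> by (intro sum.cong) (auto simp: field_simps)
  have T'': "(\<Sum>i\<in>UNIV. B $ k $ i * cnj (U i l) / of_real S) = cnj (T k l) / of_real S" for k l
    using arg_cong[OF T'[of k l], of cnj] by simp
  have U'': "(\<Sum>j\<in>UNIV. cnj (B $ k $ j) * ((if j = l then 1 else 0) + cnj (T j l) / of_real S))
      = cnj (U k l) / of_real S" for k l
    using arg_cong[OF U'[of k l], of cnj] by (simp add: if_distrib[of cnj] cong: if_cong)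
  have "(?M ** G) $ p $ q = mat 1 $ p $ q" for p q
    unfolding split
    by (cases p; cases q)
       (simp_all add: sum_UNIV_Plus coupling_def G_def block_def T' T'' U' U'' mat_def)
  then have "?M ** G = mat 1"
    by (simp add: vec_eq_iff)
  note inv = matrix_inv_unique[OF this]
  have "T k k = of_real (\<Sum>\<^sub>\<infinity>n. real (n $ k) * (cmod (c n))\<^sup>2)" for k
    by (simp add: T_def fock_inner_self square_summable_annihilate infsum_annihilate)
  with inv show "invertible ?M"
    "matrix_inv ?M $ Inl k $ Inl k
      = of_real (1 + (\<Sum>\<^sub>\<infinity>n. real (n $ k) * (cmod (c n))\<^sup>2) / (\<Sum>\<^sub>\<infinity>n. (cmod (c n))\<^sup>2))"
    "matrix_inv ?M $ Inr k $ Inr k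
      = of_real (1 + (\<Sum>\<^sub>\<infinity>n. real (n $ k) * (cmod (c n))\<^sup>2) / (\<Sum>\<^sub>\<infinity>n. (cmod (c n))\<^sup>2))"
    by (simp_all add: G_def block_def S_def)
qed

section \<open>Jacobi's formula\<close>

text \<open>In the Leibniz formula a permutation other than \<open>id\<close> moves at least two
  indices. Differentiating one factor therefore leaves an off-diagonal zero of the identity, and
  only the diagonal contributes.\<close>

lemma has_derivative_det_at_identity:
  fixes F :: "'a :: real_normed_vector \<Rightarrow> complex ^ 'n ^ 'n"
  assumes F: "\<And>i j. ((\<lambda>x. F x $ i $ j) has_derivative (\<lambda>h. D h $ i $ j)) (at x0)"
    and one: "F x0 = mat 1"
  shows "((\<lambda>x. det (F x)) has_derivative (\<lambda>h. trace (D h))) (at x0)"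
proof -
  let ?P = "{p. p permutes (UNIV :: 'n set)}"
  have zero: "(\<Prod>j\<in>UNIV - {i}. F x0 $ j $ p j) = 0" if "p \<in> ?P" "p \<noteq> id" for p i
  proof -
    have "\<exists>j. j \<noteq> i \<and> p j \<noteq> j"
    proof (rule ccontr)
      assume "\<not> ?thesis"
      then have fixed: "p j = j" if "j \<noteq> i" for j
        using that by blast
      moreover have "p i = i"
        using fixed that(1) by (metis mem_Collect_eq permutes_inj injD)
      ultimately have "p = id"
        by (metis eq_id_iff)
      with that show False by simp
    qed
    then obtain j where "j \<noteq> i" "p j \<noteq> j"
      by blast
    then show ?thesis
      by (intro prod_zero bexI[of _ j]) (auto simp: one mat_def)
  qed
  have id: "(\<Prod>j\<in>UNIV - {i}. F x0 $ j $ id j) = 1" for i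
    by (simp add: one mat_def)
  have "((\<lambda>x. det (F x)) has_derivative (\<lambda>h. \<Sum>p\<in>?P. of_int (sign p) *
      (\<Sum>i\<in>UNIV. D h $ i $ p i * (\<Prod>j\<in>UNIV - {i}. F x0 $ j $ p j)))) (at x0)"
    unfolding det_def
    by (intro has_derivative_sum has_derivative_mult_right has_derivative_prod F)
  moreover have "(\<Sum>p\<in>?P. of_int (sign p) *
      (\<Sum>i\<in>UNIV. D h $ i $ p i * (\<Prod>j\<in>UNIV - {i}. F x0 $ j $ p j))) = trace (D h)" for h
  proof -
    have "(\<Sum>i\<in>UNIV. D h $ i $ p i * (\<Prod>j\<in>UNIV - {i}. F x0 $ j $ p j)) = 0"
      if "p \<in> ?P - {id}" for p
      by (intro sum.neutral ballI) (use zero[of p] that in simp)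
    then have "(\<Sum>p\<in>?P. of_int (sign p) *
        (\<Sum>i\<in>UNIV. D h $ i $ p i * (\<Prod>j\<in>UNIV - {i}. F x0 $ j $ p j)))
      = (\<Sum>p\<in>{id}. of_int (sign p) *
        (\<Sum>i\<in>UNIV. D h $ i $ p i * (\<Prod>j\<in>UNIV - {i}. F x0 $ j $ p j)))"
      by (intro sum.mono_neutral_right ballI)
         (simp_all add: permutes_id finite_permutations del: prod_zero_iff mult_eq_0_iff)
    also have "\<dots> = trace (D h)"
      using id by (simp add: sign_id trace_def)
    finally show ?thesis .
  qed
  ultimately show ?thesis
    by simp
qed

text \<open>Reduced to the identity matrix by multiplicativity of the determinant.\<close>

lemma has_derivative_det:
  fixes F :: "'a :: real_normed_vector \<Rightarrow> complex ^ 'n ^ 'n"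
  assumes F: "\<And>i j. ((\<lambda>x. F x $ i $ j) has_derivative (\<lambda>h. D h $ i $ j)) (at x0)"
    and inv: "invertible (F x0)"
  shows "((\<lambda>x. det (F x)) has_derivative (\<lambda>h. det (F x0) * trace (matrix_inv (F x0) ** D h))) (at x0)"
proof -
  let ?N = "matrix_inv (F x0)"
  note N = invertible_matrix_inv[OF inv]
  have "((\<lambda>x. det (?N ** F x)) has_derivative (\<lambda>h. trace (?N ** D h))) (at x0)"
  proof (rule has_derivative_det_at_identity)
    show "((\<lambda>x. (?N ** F x) $ i $ j) has_derivative (\<lambda>h. (?N ** D h) $ i $ j)) (at x0)" for i j
      by (simp add: matrix_matrix_mult_def) (intro has_derivative_sum has_derivative_mult_right F)
  qed (rule N(2))
  then have "((\<lambda>x. det (F x0) * det (?N ** F x)) has_derivative (\<lambda>h. det (F x0) * trace (?N ** D h))) (at x0)"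
    by (rule has_derivative_mult_right)
  moreover have "det (F x0) * det (?N ** F x) = det (F x)" for x
    by (simp add: matrix_mul_assoc N(1) flip: det_mul)
  ultimately show ?thesis
    by simp
qed

section \<open>The norm of a squeezed state\<close>

text \<open>One factor \<open>sqrt t\<close> per photon makes the squared norm a power series in
  \<open>t\<close>, running from the vacuum component at 0 to the given state at 1.\<close>

definition damp :: "real \<Rightarrow> (nat ^ 'm \<Rightarrow> complex) \<Rightarrow> nat ^ 'm \<Rightarrow> complex" where
  "damp t c n = of_real (sqrt t ^ total n) * c n"

text \<open>Annihilation reads amplitudes with one photon more and creation with one photon fewer;
  the two missing factors \<open>sqrt t\<close> turn \<open>B\<close> into
  \<open>t *\<^sub>R B\<close>.\<close>

lemma squeezed_damp:
  fixes B :: "complex ^ 'm ^ 'm"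
  assumes "squeezed B c" "t \<ge> 0"
  shows "squeezed (t *\<^sub>R B) (damp t c)"
  unfolding squeezed_def
proof (intro allI)
  fix k n
  have "(t *\<^sub>R B) $ k $ j * create j (damp t c) n
      = of_real (sqrt t ^ Suc (total n)) * (B $ k $ j * create j c n)" for j
  proof (cases "n $ j = 0")
    case False
    then have "total n = Suc (total (n - unit j))"
      using total_add_unit[of "n - unit j" j] by (simp add: add_diff_unit)
    moreover have "complex_of_real t = of_real (sqrt t) * of_real (sqrt t)"
      using assms(2) by (simp flip: of_real_mult)
    ultimately show ?thesis
      by (simp add: create_def damp_def scaleR_conv_of_real[where 'a = complex] mult_ac)
  qed (simp add: create_def)
  then have "(\<Sum>j\<in>UNIV. (t *\<^sub>R B) $ k $ j * create j (damp t c) n)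
      = of_real (sqrt t ^ Suc (total n)) * annihilate k c n"
    using assms(1) by (simp add: squeezed_def flip: sum_distrib_left)
  then show "annihilate k (damp t c) n = (\<Sum>j\<in>UNIV. (t *\<^sub>R B) $ k $ j * create j (damp t c) n)"
    by (simp add: annihilate_def damp_def total_add_unit mult_ac)
qed

lemma cmod_damp: "t \<ge> 0 \<Longrightarrow> (cmod (damp t c n))\<^sup>2 = t ^ total n * (cmod (c n))\<^sup>2"
  by (simp add: damp_def norm_mult norm_power power_mult_distrib flip: power_mult power_even_eq)
     (simp add: power_mult mult.commute[of _ 2])

lemma coupling_scaleR: "coupling (t *\<^sub>R B) = t *\<^sub>R coupling B"
proof -
  have "coupling (t *\<^sub>R B) $ p $ q = (t *\<^sub>R coupling B) $ p $ q" for p q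
    by (cases p; cases q) (simp_all add: coupling_def block_def)
  then show ?thesis
    by (simp add: vec_eq_iff)
qed

text \<open>Grouped by level, the squared norm is the power series with coefficients
  \<open>s N\<close>, and weighting level \<open>N\<close> by \<open>N\<close> is \<open>t\<close>
  times differentiation. Both series converge because \<open>t\<close> lies inside the
  radius.\<close>

lemma squeezed_energy:
  fixes c :: "nat ^ 'm \<Rightarrow> complex"
  defines "s N \<equiv> (\<Sum>n\<in>level N. (cmod (c n))\<^sup>2)"
  assumes sm: "summable (\<lambda>N. s N * \<rho> ^ N)" and t: "0 \<le> t" "t < \<rho>"
  shows "finite_energy (damp t c)"
    and "((\<lambda>n. (cmod (damp t c n))\<^sup>2) has_sum (\<Sum>N. s N * t ^ N)) UNIV"
    and "((\<lambda>n. real (total n) * (cmod (damp t c n))\<^sup>2) has_sum t * (\<Sum>N. diffs s N * t ^ N)) UNIV"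
proof -
  have sm': "summable (\<lambda>N. s N * x ^ N)" if "norm x < \<rho>" for x
    using sm by (rule powser_inside) (use that in auto)
  have lev: "(\<Sum>n\<in>level N. (cmod (damp t c n))\<^sup>2) = s N * t ^ N" for N
    using t by (simp add: cmod_damp s_def level_def sum_distrib_left mult_ac)
  have lev': "(\<Sum>n\<in>level N. real (total n) * (cmod (damp t c n))\<^sup>2) = real N * s N * t ^ N" for N
    unfolding mult.assoc lev[symmetric] by (simp add: level_def sum_distrib_left)
  show 1: "((\<lambda>n. (cmod (damp t c n))\<^sup>2) has_sum (\<Sum>N. s N * t ^ N)) UNIV"
    using sm'[of t] t by (intro has_sum_from_levels) (auto simp: lev)
  have "summable (\<lambda>N. diffs s N * t ^ N)"
    by (rule termdiff_converges[OF _ sm']) (use t in auto)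
  then have "(\<lambda>N. diffs s N * t ^ N) sums (\<Sum>N. diffs s N * t ^ N)"
    by (rule summable_sums)
  then have "(\<lambda>N. t * (diffs s N * t ^ N)) sums (t * (\<Sum>N. diffs s N * t ^ N))"
    by (rule sums_mult)
  then have "(\<lambda>N. real (Suc N) * s (Suc N) * t ^ Suc N) sums (t * (\<Sum>N. diffs s N * t ^ N))"
    by (simp add: diffs_def mult_ac)
  \<comment> \<open>The index shift adds only the term at \<open>N = 0\<close>, which is
    zero.\<close>
  then have "(\<lambda>N. real N * s N * t ^ N) sums (t * (\<Sum>N. diffs s N * t ^ N))"
    by (subst (asm) sums_Suc_iff) simp
  then show 2: "((\<lambda>n. real (total n) * (cmod (damp t c n))\<^sup>2) has_sum t * (\<Sum>N. diffs s N * t ^ N)) UNIV"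
    by (intro has_sum_from_levels) (auto simp: lev')
  show "finite_energy (damp t c)"
    using has_sum_add[OF 1 2] unfolding finite_energy_def
    by (auto simp: summable_on_def algebra_simps)
qed

lemma damp_one [simp]: "damp 1 c = c"
  by (simp add: fun_eq_iff damp_def)

lemma damp_zero: "damp t c 0 = c 0"
  by (simp add: damp_def total_def)

lemma trace_Plus:
  "trace M = (\<Sum>k\<in>UNIV. M $ Inl k $ Inl k + M $ Inr k $ Inr k)"
  for M :: "complex ^ ('m :: finite + 'm) ^ ('m + 'm)"
  by (simp add: trace_def sum_UNIV_Plus sum.distrib)

text \<open>
  Along the ray \<open>t *\<^sub>R B\<close> the squared norm \<open>S\<close> of the damped state satisfies \<open>t S' / S = \<Sum>\<langle>n\<^sub>k\<rangle>\<close>, and by the moment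
  formula and Jacobi's formula \<open>det (mat 1 - t *\<^sub>R coupling B)\<close> has logarithmic derivative \<open>- 2 S' / S\<close>.
\<close>

lemma squeezed_norm:
  fixes B :: "complex ^ 'm ^ 'm"
  assumes sq: "squeezed B c" and sv: "\<And>s. singular_value B s \<Longrightarrow> s < 1" and c0: "c 0 = 1"
  shows "finite_energy c"
    and "Re (det (mat 1 - coupling B)) * (\<Sum>\<^sub>\<infinity>n. (cmod (c n))\<^sup>2)\<^sup>2 = 1"
proof -
  define s where "s N = (\<Sum>n\<in>level N. (cmod (c n))\<^sup>2)" for N
  obtain \<rho> where \<rho>: "\<rho> > 1" and sm: "summable (\<lambda>N. s N * \<rho> ^ N)"
    using level_weights_summable[OF sq sv] unfolding s_def by blast
  note energy = squeezed_energy[of c, folded s_def, OF sm]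
  show "finite_energy c"
    using energy(1)[of 1] \<rho> by simp
  define S where "S t = (\<Sum>N. s N * t ^ N)" for t
  define S' where "S' t = (\<Sum>N. diffs s N * t ^ N)" for t
  define F where "F t = mat 1 - t *\<^sub>R coupling B" for t :: real
  have dS: "(S has_real_derivative S' t) (at t)" if "0 \<le> t" "t \<le> 1" for t
    unfolding S_def S'_def by (rule termdiffs_strong[OF sm]) (use that \<rho> in auto)
  have F: "invertible (F t)" "S t \<noteq> 0"
      "t \<noteq> 0 \<Longrightarrow> trace (matrix_inv (F t) ** (- coupling B)) = - of_real (2 * S' t / S t)"
      if t: "0 \<le> t" "t \<le> 1" for t
  proof -
    have "t < \<rho>"
      using t \<rho> by simp
    note en = energy[OF t(1) this, folded S_def S'_def]
    interpret finite_energy "damp t c"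
      by (rule en(1))
    have St: "(\<Sum>\<^sub>\<infinity>n. (cmod (damp t c n))\<^sup>2) = S t"
      using en(2) by (rule infsumI)
    have "damp t c 0 \<noteq> 0"
      by (simp add: damp_zero c0)
    note mom = squeezed_moments[OF squeezed_damp[OF sq t(1)] en(1) this,
        unfolded coupling_scaleR St, folded F_def]
    show inv: "invertible (F t)"
      by (rule mom(1))
    have "(cmod (damp t c 0))\<^sup>2 \<le> S t"
      unfolding St[symmetric]
      using infsum_mono2[of "\<lambda>n. (cmod (damp t c n))\<^sup>2" "{0}" UNIV] square_summable_state
      by (simp add: square_summable_def)
    then show "S t \<noteq> 0"
      by (auto simp: damp_zero c0)
    let ?T = "\<lambda>k. (\<Sum>\<^sub>\<infinity>n. real (n $ k) * (cmod (damp t c n))\<^sup>2)"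
    have "((\<lambda>n. \<Sum>k\<in>UNIV. real (n $ k) * (cmod (damp t c n))\<^sup>2) has_sum (\<Sum>k\<in>UNIV. ?T k)) UNIV"
      by (intro has_sum_finite_sum has_sum_infsum number_summable)
    then have "((\<lambda>n. real (total n) * (cmod (damp t c n))\<^sup>2) has_sum (\<Sum>k\<in>UNIV. ?T k)) UNIV"
      by (simp add: total_def sum_distrib_right)
    then have T: "(\<Sum>k\<in>UNIV. ?T k) = t * S' t"
      using en(3) has_sum_unique by blast
    have "trace (matrix_inv (F t)) = (\<Sum>k\<in>UNIV. of_real (2 + 2 * (?T k / S t)))"
      unfolding trace_Plus mom(2,3) by (intro sum.cong) auto
    also have "\<dots> = of_real (2 * real CARD('m) + 2 * (t * S' t) / S t)"
      unfolding T[symmetric]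
      by (simp add: sum.distrib sum_divide_distrib sum_distrib_left)
    finally have tr: "trace (matrix_inv (F t)) = of_real (2 * real CARD('m) + 2 * (t * S' t) / S t)" .
    \<comment> \<open>Since \<open>F t - mat 1\<close> is \<open>- t\<close> times the coupling
      matrix, the trace reduces to diagonal entries of the inverse. Dividing by \<open>t\<close>
      afterwards excludes \<open>t = 0\<close>.\<close>
    have "of_real t * trace (matrix_inv (F t) ** (- coupling B))
        = trace (matrix_inv (F t) ** (F t - mat 1))"
      by (simp add: F_def trace_def matrix_matrix_mult_def sum_distrib_left sum_negf scaleR_conv_of_real[where 'a = complex] mult_ac)
    also have "\<dots> = trace (mat 1 - matrix_inv (F t) :: complex ^ ('m + 'm) ^ ('m + 'm))"
      using invertible_matrix_inv(2)[OF inv] by (simp add: matrix_mult_diff_left)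
    also have "\<dots> = - of_real (2 * (t * S' t) / S t)"
      by (simp add: trace_sub trace_I tr)
    finally have *: "of_real t * trace (matrix_inv (F t) ** (- coupling B)) = - of_real (2 * (t * S' t) / S t)" .
    show "trace (matrix_inv (F t) ** (- coupling B)) = - of_real (2 * S' t / S t)" if "t \<noteq> 0"
    proof -
      have "of_real t * trace (matrix_inv (F t) ** (- coupling B)) = of_real t * (- of_real (2 * S' t / S t))"
        unfolding * by simp
      then show ?thesis
        using that by (metis mult_left_cancel of_real_eq_0_iff)
    qed
  qed
  have dF: "((\<lambda>t. det (F t)) has_derivative (\<lambda>h. det (F t) * trace (matrix_inv (F t) ** (h *\<^sub>R (- coupling B))))) (at t)"
    if "0 \<le> t" "t \<le> 1" for t
  proof (rule has_derivative_det)
    show "((\<lambda>t. F t $ i $ j) has_derivative (\<lambda>h. (h *\<^sub>R (- coupling B)) $ i $ j)) (at t)" for i j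
      unfolding F_def by (auto intro!: derivative_eq_intros)
  qed (rule F(1)[OF that])
  define d where "d t = Re (det (F t))" for t
  have dd: "(d has_derivative (\<lambda>h. Re (det (F t) * trace (matrix_inv (F t) ** (h *\<^sub>R (- coupling B)))))) (at t)"
    if "0 \<le> t" "t \<le> 1" for t
    unfolding d_def by (rule has_derivative_Re[OF dF[OF that]])
  have "d 1 * (S 1)\<^sup>2 = d 0 * (S 0)\<^sup>2"
  \<comment> \<open>The logarithmic derivatives of \<open>d\<close> and of the square of
    \<open>S\<close> cancel in the open interval; continuity carries the constant to the end points,
    including 0.\<close>
  proof (rule DERIV_isconst_end[of 0 1 "\<lambda>t. d t * (S t)\<^sup>2"])
    show "continuous_on {0..1} (\<lambda>t. d t * (S t)\<^sup>2)"
    proof (intro continuous_at_imp_continuous_on ballI)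
      fix t :: real assume "t \<in> {0..1}"
      then have "isCont d t" "isCont S t"
        using has_derivative_continuous[OF dd[of t]] DERIV_isCont[OF dS[of t]] by simp_all
      then show "isCont (\<lambda>t. d t * (S t)\<^sup>2) t"
        by (intro isCont_mult isCont_power)
    qed
    fix t :: real assume t: "0 < t" "t < 1"
    have tr: "trace (matrix_inv (F t) ** (h *\<^sub>R (- coupling B))) = - of_real (2 * S' t / S t * h)" for h
    proof -
      have "trace (matrix_inv (F t) ** (h *\<^sub>R (- coupling B))) = of_real h * trace (matrix_inv (F t) ** (- coupling B))"
        by (simp add: trace_def matrix_matrix_mult_def sum_distrib_left scaleR_conv_of_real[where 'a = complex] sum_negf mult_ac)
      then show ?thesis
        using F(3)[of t] t by simp
    qed
    have "(\<lambda>h. Re (det (F t) * trace (matrix_inv (F t) ** (h *\<^sub>R (- coupling B))))) = (*) (- (2 * S' t / S t) * d t)"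
      by (rule ext) (simp only: tr d_def, simp)
    then have "(d has_real_derivative - (2 * S' t / S t) * d t) (at t)"
      using dd[of t] t by (simp add: has_field_derivative_def)
    moreover have "(S has_real_derivative S' t) (at t)"
      using dS t by simp
    ultimately have "((\<lambda>t. d t * (S t)\<^sup>2) has_real_derivative
        (- (2 * S' t / S t) * d t) * (S t)\<^sup>2 + d t * (2 * S t * S' t)) (at t)"
      by (auto intro!: derivative_eq_intros)
    then show "((\<lambda>t. d t * (S t)\<^sup>2) has_real_derivative 0) (at t)"
      using F(2)[of t] t by (simp add: power2_eq_square)
  qed simp
  moreover have "S 0 = 1"
  proof -
    \<comment> \<open>At \<open>t = 0\<close> only the vacuum amplitude is left.\<close>
    have "S 0 = s 0"
      unfolding S_def by (rule powser_zero)
    also have "level 0 = {0 :: nat ^ 'm}"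
      by (auto simp: level_def total_def vec_eq_iff)
    then have "s 0 = 1"
      by (simp add: s_def c0)
    finally show ?thesis .
  qed
  moreover have "d 0 = 1"
    by (simp add: d_def F_def)
  moreover have "(\<Sum>\<^sub>\<infinity>n. (cmod (c n))\<^sup>2) = S 1"
    using energy(2)[of 1] \<rho> unfolding S_def by (simp add: infsumI)
  ultimately show "Re (det (mat 1 - coupling B)) * (\<Sum>\<^sub>\<infinity>n. (cmod (c n))\<^sup>2)\<^sup>2 = 1"
    by (simp add: d_def F_def)
qed

section \<open>Derivatives of the photon-number distribution\<close>

definition weight :: "real ^ 'm \<Rightarrow> nat ^ 'm \<Rightarrow> real" where
  "weight w n = (\<Prod>i\<in>UNIV. (w $ i) ^ (n $ i) / fact (n $ i))"

definition amplitude :: "complex ^ 'm ^ 'm \<Rightarrow> real ^ 'm \<Rightarrow> nat ^ 'm \<Rightarrow> complex" where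
  "amplitude A w n = Haf_rep A n * of_real (sqrt (weight w n))"

lemma weight_add_unit: "weight w (n + unit k) = weight w n * (w $ k / (real (n $ k) + 1))"
proof -
  have "(\<Prod>i\<in>UNIV - {k}. (w $ i) ^ ((n + unit k) $ i) / fact ((n + unit k) $ i))
      = (\<Prod>i\<in>UNIV - {k}. (w $ i) ^ (n $ i) / fact (n $ i))"
    by (intro prod.cong) auto
  then show ?thesis
    unfolding weight_def by (simp add: prod.remove[of UNIV k] field_simps)
qed

lemma A_W_nth: "A_W A w $ i $ j = of_real (sqrt (w $ i)) * A $ i $ j * of_real (sqrt (w $ j))"
proof -
  have "(W_mat w ** A) $ i $ j = of_real (sqrt (w $ i)) * A $ i $ j" for i j
    by (simp add: matrix_matrix_mult_def W_mat_def if_distrib[where f = "\<lambda>x. x * _"] cong: if_cong)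
  then show ?thesis
    by (simp add: A_W_def matrix_matrix_mult_def[of "W_mat w ** A"])
       (simp add: W_mat_def if_distrib[where f = "\<lambda>x. _ * x"] cong: if_cong)
qed

text \<open>The factor \<open>n $ j\<close> in the Hafnian expansion splits into two square roots:
  one belongs to \<open>create j\<close>, the other converts the weight of \<open>n\<close> into
  that of \<open>n - unit j\<close>. The same conversion at \<open>n + unit k\<close> supplies the
  root of \<open>w $ k\<close>, completing the entry of \<open>A_W A w\<close>.\<close>

lemma squeezed_amplitude:
  fixes A :: "complex ^ 'm ^ 'm"
  assumes "transpose A = A" "\<And>k. w $ k > 0"
  shows "squeezed (A_W A w) (amplitude A w)"
  unfolding squeezed_def
proof (intro allI)
  fix k n
  define r where "r i = complex_of_real (sqrt (w $ i))" for i
  define W where "W n = complex_of_real (sqrt (weight w n))" for n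
  define N where "N x = complex_of_real (sqrt (real x))" for x
  have W: "W (n + unit j) * N (Suc (n $ j)) = W n * r j" for n j
    unfolding W_def N_def r_def weight_add_unit of_real_mult[symmetric] of_real_eq_iff
    by (simp add: real_sqrt_mult real_sqrt_divide add.commute[of 1])
  have N: "N x * N x = of_nat x" for x
    unfolding N_def of_real_mult[symmetric] by simp
  have "annihilate k (amplitude A w) n = Haf_rep A (n + unit k) * (W (n + unit k) * N (Suc (n $ k)))"
    by (simp add: annihilate_def amplitude_def W_def N_def mult_ac add.commute[of 1])
  also have "\<dots> = (\<Sum>j\<in>UNIV. A $ k $ j * (of_nat (n $ j) * Haf_rep A (n - unit j))) * (W n * r k)"
    by (simp only: W Haf_rep_step[OF assms(1), folded unit_def])
  also have "\<dots> = (\<Sum>j\<in>UNIV. A_W A w $ k $ j * create j (amplitude A w) n)"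
    unfolding sum_distrib_right
  proof (rule sum.cong[OF refl])
    fix j
    show "A $ k $ j * (of_nat (n $ j) * Haf_rep A (n - unit j)) * (W n * r k)
        = A_W A w $ k $ j * create j (amplitude A w) n"
    proof (cases "n $ j = 0")
      case False
      then have "W n * N (n $ j) = W (n - unit j) * r j"
        using W[of "n - unit j" j] by (simp add: add_diff_unit)
      moreover have "A_W A w $ k $ j * create j (amplitude A w) n
          = r k * A $ k $ j * N (n $ j) * Haf_rep A (n - unit j) * (W (n - unit j) * r j)"
        by (simp add: A_W_nth create_def amplitude_def r_def W_def N_def mult_ac)
      ultimately have "A_W A w $ k $ j * create j (amplitude A w) n
          = r k * A $ k $ j * N (n $ j) * Haf_rep A (n - unit j) * (W n * N (n $ j))"
        by (simp only:)
      then show ?thesis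
        by (simp only: N[symmetric] mult_ac)
    qed (simp add: create_def)
  qed
  finally show "annihilate k (amplitude A w) n = (\<Sum>j\<in>UNIV. A_W A w $ k $ j * create j (amplitude A w) n)" .
qed

lemma weight_nonneg: "(\<And>k. w $ k > 0) \<Longrightarrow> weight w n \<ge> 0"
  unfolding weight_def by (intro prod_nonneg ballI divide_nonneg_nonneg) (auto simp: less_imp_le)

lemma amplitude_zero: "amplitude A w 0 = 1"
  by (simp add: amplitude_def Haf_rep_zero weight_def)

lemma P_AW_amplitude:
  "(\<And>k. w $ k > 0) \<Longrightarrow> P_AW A w n = inv_Z A w * (cmod (amplitude A w n))\<^sup>2"
  using weight_nonneg[of w n]
  by (simp add: P_AW_def amplitude_def norm_mult power_mult_distrib flip: weight_def)

lemma inv_Z_coupling: "inv_Z A w = sqrt (Re (det (mat 1 - coupling (A_W A w))))"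
  by (simp add: inv_Z_def X_mat_calA_W coupling_def)

lemma photon_statistics:
  fixes A :: "complex ^ 'm ^ 'm"
  assumes sym: "transpose A = A" and w: "w \<in> weight_domain A"
  shows "invertible (mat 1 - coupling (A_W A w))"
    and "inv_Z A w > 0"
    and "matrix_inv (mat 1 - coupling (A_W A w)) $ Inl k $ Inl k = of_real (1 + mean_photons A w k)"
    and "matrix_inv (mat 1 - coupling (A_W A w)) $ Inr k $ Inr k = of_real (1 + mean_photons A w k)"
    and "(\<lambda>n. real (n $ k) * P_AW A w n) summable_on UNIV"
proof -
  have pos: "w $ k > 0" for k
    using w by (simp add: weight_domain_def)
  have sv: "s < 1" if "singular_value (A_W A w) s" for s
    using w that by (auto simp: weight_domain_def)
  let ?c = "amplitude A w"
  define S where "S = (\<Sum>\<^sub>\<infinity>n. (cmod (?c n))\<^sup>2)"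
  note sq = squeezed_amplitude[OF sym pos]
  note nrm = squeezed_norm[OF sq sv amplitude_zero]
  interpret finite_energy ?c
    by (rule nrm(1))
  have "?c 0 \<noteq> 0"
    by (simp add: amplitude_zero)
  note mom = squeezed_moments[OF sq nrm(1) this]
  show "invertible (mat 1 - coupling (A_W A w))"
    by (rule mom(1))
  have "S \<ge> 0"
    unfolding S_def by (intro infsum_nonneg) auto
  moreover have "S \<noteq> 0"
    using nrm(2) by (auto simp: S_def)
  ultimately have "S > 0"
    by simp
  \<comment> \<open>The determinant identity says that \<open>inv_Z\<close> is the reciprocal of the
    squared norm, so dividing moments by \<open>S\<close> gives expectations under
    \<open>P_AW\<close>.\<close>
  have "Re (det (mat 1 - coupling (A_W A w))) = (1 / S)\<^sup>2"
    using nrm(2) \<open>S > 0\<close> by (simp add: S_def[symmetric] field_simps)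
  then have Z: "inv_Z A w = 1 / S"
    using \<open>S > 0\<close> by (simp add: inv_Z_coupling)
  then show "inv_Z A w > 0"
    using \<open>S > 0\<close> by simp
  have P: "real (n $ k) * P_AW A w n = (1 / S) * (real (n $ k) * (cmod (?c n))\<^sup>2)" for n k
    by (simp add: P_AW_amplitude[OF pos] Z)
  have mean: "mean_photons A w k = (\<Sum>\<^sub>\<infinity>n. real (n $ k) * (cmod (?c n))\<^sup>2) / S" for k
    unfolding mean_photons_def P infsum_cmult_right' by simp
  show "(\<lambda>n. real (n $ k) * P_AW A w n) summable_on UNIV"
    unfolding P by (intro summable_on_cmult_right number_summable)
  show "matrix_inv (mat 1 - coupling (A_W A w)) $ Inl k $ Inl k = of_real (1 + mean_photons A w k)"
    and "matrix_inv (mat 1 - coupling (A_W A w)) $ Inr k $ Inr k = of_real (1 + mean_photons A w k)"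
    by (simp_all only: mom(2,3) mean S_def)
qed

section \<open>Differentiation in the weights\<close>

lemma has_derivative_A_W:
  assumes "\<And>k. w $ k > 0"
  shows "((\<lambda>w. A_W A w $ i $ j) has_derivative
    (\<lambda>h. of_real (h $ i / (2 * w $ i) + h $ j / (2 * w $ j)) * A_W A w $ i $ j)) (at w)"
proof -
  \<comment> \<open>Logarithmic form: the derivative is a multiple of the function itself, so each
    matrix entry reappears in its own derivative.\<close>
  have r: "((\<lambda>w. sqrt (w $ i)) has_derivative (\<lambda>h. h $ i / (2 * w $ i) * sqrt (w $ i))) (at w)" for i
  proof -
    have d: "((\<lambda>w. sqrt (w $ i)) has_derivative (\<lambda>h. h $ i * (inverse (sqrt (w $ i)) / 2))) (at w)"
      using assms[of i]
      by (intro has_derivative_real_sqrt bounded_linear_imp_has_derivative bounded_linear_vec_nth) auto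
    have "x * (inverse (sqrt (w $ i)) / 2) = x / (2 * w $ i) * sqrt (w $ i)" for x
      using assms[of i] real_sqrt_mult_self[of "w $ i"] by (simp add: field_simps)
    then show ?thesis
      by (intro has_derivative_eq_rhs[OF d] ext)
  qed
  have rr: "((\<lambda>w. sqrt (w $ i) * sqrt (w $ j)) has_derivative
      (\<lambda>h. (h $ i / (2 * w $ i) + h $ j / (2 * w $ j)) * (sqrt (w $ i) * sqrt (w $ j)))) (at w)"
    by (rule has_derivative_eq_rhs[OF has_derivative_mult[OF r r]]) (auto simp: algebra_simps)
  have "((\<lambda>w. A $ i $ j * of_real (sqrt (w $ i) * sqrt (w $ j))) has_derivative
      (\<lambda>h. A $ i $ j * of_real ((h $ i / (2 * w $ i) + h $ j / (2 * w $ j)) * (sqrt (w $ i) * sqrt (w $ j))))) (at w)"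
    by (intro has_derivative_mult_right has_derivative_of_real rr)
  then show ?thesis
    unfolding A_W_nth by (simp add: mult_ac)
qed

definition mode :: "'m + 'm \<Rightarrow> 'm" where
  "mode p = (case p of Inl i \<Rightarrow> i | Inr i \<Rightarrow> i)"

text \<open>The derivative of \<open>C\<close> is \<open>a C + C a\<close> with a diagonal matrix
  \<open>a\<close>. In Jacobi's formula this leaves only the diagonal of
  \<open>matrix_inv M - mat 1\<close>, whose entries are the mean photon numbers; the square root
  then halves the result.\<close>

lemma has_derivative_inv_Z:
  fixes A :: "complex ^ 'm ^ 'm"
  assumes sym: "transpose A = A" and w: "w \<in> weight_domain A"
  shows "((\<lambda>w. inv_Z A w) has_derivative
    (\<lambda>h. - inv_Z A w * (\<Sum>k\<in>UNIV. h $ k * (mean_photons A w k / w $ k)))) (at w)"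
proof -
  have pos: "w $ k > 0" for k
    using w by (simp add: weight_domain_def)
  define C where "C = coupling (A_W A w)"
  define M where "M = mat 1 - C"
  define a where "a h p = complex_of_real (h $ mode p / (2 * w $ mode p))" for h :: "real ^ 'm" and p
  define D where "D h = (\<chi> p q. - ((a h p + a h q) * C $ p $ q))" for h
  note ps = photon_statistics[OF sym w, folded C_def, folded M_def]
  have "((\<lambda>w. (mat 1 - coupling (A_W A w)) $ p $ q) has_derivative (\<lambda>h. D h $ p $ q)) (at w)" for p q
  proof -
    have "((\<lambda>w. coupling (A_W A w) $ p $ q) has_derivative (\<lambda>h. (a h p + a h q) * C $ p $ q)) (at w)"
      using has_derivative_A_W[OF pos] has_derivative_cnj[OF has_derivative_A_W[OF pos]]
      by (cases p; cases q) (simp_all add: coupling_def block_def C_def a_def mode_def)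
    then show ?thesis
      by (auto simp: D_def intro!: derivative_eq_intros)
  qed
  then have "((\<lambda>w. det (mat 1 - coupling (A_W A w))) has_derivative
      (\<lambda>h. det M * trace (matrix_inv M ** D h))) (at w)"
    unfolding M_def C_def by (rule has_derivative_det) (use ps(1) in \<open>simp add: M_def C_def\<close>)
  moreover have "trace (matrix_inv M ** D h) = of_real (- 2 * (\<Sum>k\<in>UNIV. h $ k * (mean_photons A w k / w $ k)))" for h
  proof -
    let ?N = "matrix_inv M"
    have NC: "?N ** C = ?N - mat 1" "C ** ?N = ?N - mat 1"
    proof -
      have C: "C = mat 1 - M"
        by (simp add: M_def)
      show "?N ** C = ?N - mat 1" "C ** ?N = ?N - mat 1"
        by (simp_all add: C matrix_mult_diff_left matrix_mult_diff_right invertible_matrix_inv[OF ps(1)])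
    qed
    \<comment> \<open>The trace is split by the side on which \<open>a\<close> stands; exchanging
      the sums plays the role of cyclicity.\<close>
    have "trace (?N ** D h) = - (\<Sum>p\<in>UNIV. \<Sum>q\<in>UNIV. a h p * (?N $ p $ q * C $ q $ p))
        - (\<Sum>p\<in>UNIV. \<Sum>q\<in>UNIV. a h q * (C $ q $ p * ?N $ p $ q))"
      unfolding trace_def matrix_matrix_mult_def sum_negf[symmetric] sum_subtractf[symmetric] vec_lambda_beta
      by (intro sum.cong refl) (simp add: D_def algebra_simps)
    also have "(\<Sum>p\<in>UNIV. \<Sum>q\<in>UNIV. a h q * (C $ q $ p * ?N $ p $ q))
        = (\<Sum>q\<in>UNIV. \<Sum>p\<in>UNIV. a h q * (C $ q $ p * ?N $ p $ q))"
      by (rule sum.swap)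
    also have "\<dots> = (\<Sum>q\<in>UNIV. a h q * (C ** ?N) $ q $ q)"
      by (simp add: matrix_matrix_mult_def sum_distrib_left)
    also have "(\<Sum>p\<in>UNIV. \<Sum>q\<in>UNIV. a h p * (?N $ p $ q * C $ q $ p)) = (\<Sum>p\<in>UNIV. a h p * (?N ** C) $ p $ p)"
      by (simp add: matrix_matrix_mult_def sum_distrib_left)
    also have "- (\<Sum>p\<in>UNIV. a h p * (?N ** C) $ p $ p) - (\<Sum>q\<in>UNIV. a h q * (C ** ?N) $ q $ q)
        = - 2 * (\<Sum>p\<in>UNIV. a h p * (?N $ p $ p - 1))"
      unfolding NC by (simp add: mat_def)
    \<comment> \<open>\<open>Inl k\<close> and \<open>Inr k\<close> contribute equally, which
      cancels the 2 in the denominator of \<open>a\<close>.\<close>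
    also have "(\<Sum>p\<in>UNIV. a h p * (?N $ p $ p - 1)) = (\<Sum>k\<in>UNIV. of_real (h $ k * (mean_photons A w k / w $ k)))"
      unfolding sum_UNIV_Plus ps(3,4) sum.distrib[symmetric]
      by (intro sum.cong) (simp_all add: a_def mode_def flip: add_divide_distrib)
    finally show ?thesis
      by simp
  qed
  ultimately have "((\<lambda>w. Re (det (mat 1 - coupling (A_W A w)))) has_derivative
      (\<lambda>h. Re (det M) * (- 2 * (\<Sum>k\<in>UNIV. h $ k * (mean_photons A w k / w $ k))))) (at w)"
    using has_derivative_Re by (force simp del: of_real_mult of_real_minus of_real_sum)
  moreover have "Re (det M) > 0"
    using ps(2) by (simp add: inv_Z_coupling M_def C_def)
  ultimately have d: "((\<lambda>w. sqrt (Re (det (mat 1 - coupling (A_W A w))))) has_derivative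
      (\<lambda>h. (Re (det M) * (- 2 * (\<Sum>k\<in>UNIV. h $ k * (mean_photons A w k / w $ k)))) * (inverse (sqrt (Re (det M))) / 2))) (at w)"
    unfolding M_def C_def by (intro has_derivative_real_sqrt)
  have "(Re (det M) * (- 2 * x)) * (inverse (sqrt (Re (det M))) / 2) = - sqrt (Re (det M)) * x" for x
    using \<open>Re (det M) > 0\<close> real_sqrt_mult_self[of "Re (det M)"] by (simp add: field_simps)
  then show ?thesis
    unfolding inv_Z_coupling M_def[symmetric] C_def[symmetric] by (intro has_derivative_eq_rhs[OF d[folded M_def C_def]] ext)
qed

lemma has_derivative_weight:
  assumes "\<And>k. w $ k > 0"
  shows "((\<lambda>w. weight w n) has_derivative (\<lambda>h. weight w n * (\<Sum>k\<in>UNIV. h $ k * (real (n $ k) / w $ k)))) (at w)"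
proof -
  have "((\<lambda>w. (w $ i) ^ (n $ i) / fact (n $ i)) has_derivative
      (\<lambda>h. (w $ i) ^ (n $ i) / fact (n $ i) * (h $ i * (real (n $ i) / w $ i)))) (at w)" for i
  proof -
    have "((\<lambda>w. (w $ i) ^ (n $ i) / fact (n $ i)) has_derivative
        (\<lambda>h. (real (n $ i) * h $ i * (w $ i) ^ (n $ i - 1)) / fact (n $ i))) (at w)"
      unfolding divide_inverse
      by (intro has_derivative_mult_left has_derivative_power bounded_linear_imp_has_derivative bounded_linear_vec_nth)
    moreover have "real (n $ i) * x * (w $ i) ^ (n $ i - 1) / fact (n $ i)
        = (w $ i) ^ (n $ i) / fact (n $ i) * (x * (real (n $ i) / w $ i))" for x
      using assms[of i] by (cases "n $ i") (simp_all add: field_simps del: fact_Suc of_nat_Suc)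
    ultimately show ?thesis
      by simp
  qed
  then have "((\<lambda>w. weight w n) has_derivative (\<lambda>h. \<Sum>i\<in>UNIV. (w $ i) ^ (n $ i) / fact (n $ i) * (h $ i * (real (n $ i) / w $ i))
      * (\<Prod>j\<in>UNIV - {i}. (w $ j) ^ (n $ j) / fact (n $ j)))) (at w)"
    unfolding weight_def by (intro has_derivative_prod)
  moreover have "(\<lambda>h. \<Sum>i\<in>UNIV. (w $ i) ^ (n $ i) / fact (n $ i) * (h $ i * (real (n $ i) / w $ i))
      * (\<Prod>j\<in>UNIV - {i}. (w $ j) ^ (n $ j) / fact (n $ j)))
    = (\<lambda>h. weight w n * (\<Sum>k\<in>UNIV. h $ k * (real (n $ k) / w $ k)))"
    unfolding sum_distrib_left
  proof (intro ext sum.cong refl)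
    fix h :: "real ^ 'a" and i
    have "weight w n = (w $ i) ^ (n $ i) / fact (n $ i) * (\<Prod>j\<in>UNIV - {i}. (w $ j) ^ (n $ j) / fact (n $ j))"
      unfolding weight_def by (rule prod.remove) auto
    then show "(w $ i) ^ (n $ i) / fact (n $ i) * (h $ i * (real (n $ i) / w $ i))
        * (\<Prod>j\<in>UNIV - {i}. (w $ j) ^ (n $ j) / fact (n $ j)) = weight w n * (h $ i * (real (n $ i) / w $ i))"
      by (simp only: mult_ac)
  qed
  ultimately show ?thesis
    by simp
qed

text \<open>The logarithmic derivatives of weight and normalisation add up to photon number minus
  mean. With the total derivative available, partial derivatives and parameter gradients both follow
  by the chain rule.\<close>

lemma has_derivative_P_AW:
  fixes A :: "complex ^ 'm ^ 'm"
  assumes sym: "transpose A = A" and w: "w \<in> weight_domain A"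
  shows "((\<lambda>w. P_AW A w n) has_derivative
    (\<lambda>h. \<Sum>k\<in>UNIV. h $ k * ((real (n $ k) - mean_photons A w k) / w $ k * P_AW A w n))) (at w)"
proof -
  have pos: "w $ k > 0" for k
    using w by (simp add: weight_domain_def)
  let ?m = "\<lambda>h. \<Sum>k\<in>UNIV. h $ k * (mean_photons A w k / w $ k)"
  let ?n = "\<lambda>h. \<Sum>k\<in>UNIV. h $ k * (real (n $ k) / w $ k)"
  have P: "P_AW A w n = inv_Z A w * (cmod (Haf_rep A n))\<^sup>2 * weight w n" for w
    by (simp add: P_AW_def weight_def)
  have "((\<lambda>w. P_AW A w n) has_derivative
      (\<lambda>h. inv_Z A w * (cmod (Haf_rep A n))\<^sup>2 * (weight w n * ?n h)
        + - inv_Z A w * ?m h * (cmod (Haf_rep A n))\<^sup>2 * weight w n)) (at w)"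
    unfolding P
    by (intro has_derivative_mult has_derivative_mult_left has_derivative_inv_Z[OF sym w] has_derivative_weight pos)
  moreover have "inv_Z A w * (cmod (Haf_rep A n))\<^sup>2 * (weight w n * ?n h)
      + - inv_Z A w * ?m h * (cmod (Haf_rep A n))\<^sup>2 * weight w n
      = (\<Sum>k\<in>UNIV. h $ k * ((real (n $ k) - mean_photons A w k) / w $ k * P_AW A w n))" for h
  proof -
    have "(\<Sum>k\<in>UNIV. h $ k * ((real (n $ k) - mean_photons A w k) / w $ k * P_AW A w n)) = (?n h - ?m h) * P_AW A w n"
      by (simp add: sum_subtractf[symmetric] sum_distrib_right diff_divide_distrib right_diff_distrib left_diff_distrib mult.assoc)
    then show ?thesis
      unfolding P by (simp add: algebra_simps)
  qed
  ultimately show ?thesis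
    by simp
qed

text \<open>A total derivative guarantees that each \<open>deriv\<close> in \<open>gradient\<close>
  is a genuine directional derivative and not a default value.\<close>

lemma gradient_nth:
  assumes "(f has_derivative f') (at \<theta>)"
  shows "gradient f \<theta> $ j = f' (axis j 1)"
proof -
  have "((\<lambda>t. \<theta> + t *\<^sub>R axis j 1) has_derivative (\<lambda>s. s *\<^sub>R axis j 1)) (at (0::real))"
    by (auto intro!: derivative_eq_intros)
  then have "((\<lambda>t. f (\<theta> + t *\<^sub>R axis j 1)) has_derivative (\<lambda>s. f' (s *\<^sub>R axis j 1))) (at 0)"
    using assms by (intro has_derivative_compose[of _ _ 0 UNIV f f']) auto
  moreover have "(\<lambda>s. f' (s *\<^sub>R axis j 1)) = (*) (f' (axis j 1))"
    using linear_cmul[OF has_derivative_linear[OF assms]] by (simp add: fun_eq_iff)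
  ultimately have "((\<lambda>t. f (\<theta> + t *\<^sub>R axis j 1)) has_real_derivative f' (axis j 1)) (at 0)"
    by (simp add: has_field_derivative_def)
  then show ?thesis
    by (simp add: gradient_def DERIV_imp_deriv)
qed

theorem mainTheorem2:
  fixes A :: "complex ^ 'm ^ 'm"
  assumes "transpose A = A"
  shows
    "(\<forall>w\<in>weight_domain A. \<forall>n k.
        ((\<lambda>t. P_AW A (\<chi> i. if i = k then t else w $ i) n) has_real_derivative
          (real (n $ k) - mean_photons A w k) / w $ k * P_AW A w n) (at (w $ k)))
   \<and> (\<forall>w\<in>weight_domain A. \<forall>k.
        (\<lambda>n. real (n $ k) * P_AW A w n) summable_on UNIV
      \<and> complex_of_real (mean_photons A w k)
          = (cov_V A w $ Inl k $ Inl k + cov_V A w $ Inr k $ Inr k - 1) / 2)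
   \<and> (\<forall>(S :: (real ^ 'd) set) w.
        open S \<and> w differentiable_on S \<and> w ` S \<subseteq> weight_domain A \<longrightarrow>
        (\<forall>\<theta>\<in>S. \<forall>n.
           (\<lambda>\<theta>. P_AW A (w \<theta>) n) differentiable (at \<theta>)
         \<and> gradient (\<lambda>\<theta>. P_AW A (w \<theta>) n) \<theta>
             = (\<Sum>k\<in>UNIV. ((real (n $ k) - mean_photons A (w \<theta>) k) * P_AW A (w \<theta>) n)
                  *\<^sub>R gradient (\<lambda>\<theta>. ln (w \<theta> $ k)) \<theta>)))"
proof (intro conjI ballI allI impI)
  fix w n k assume w: "w \<in> weight_domain A"
  let ?D = "\<lambda>k. (real (n $ k) - mean_photons A w k) / w $ k * P_AW A w n"
  have curve: "(\<chi> i. if i = k then t else w $ i) = w + (t - w $ k) *\<^sub>R axis k 1" for t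
    by (simp add: vec_eq_iff axis_def)
  have c: "((\<lambda>t. w + (t - w $ k) *\<^sub>R axis k 1) has_derivative (\<lambda>s. s *\<^sub>R axis k 1)) (at (w $ k))"
    by (auto intro!: derivative_eq_intros)
  \<comment> \<open>The base point is rewritten as the value of the line at \<open>w $ k\<close>,
    the form that the chain rule expects.\<close>
  have "w = w + (w $ k - w $ k) *\<^sub>R axis k 1"
    by simp
  note P = has_derivative_P_AW[OF assms w, of n, THEN back_subst[of "\<lambda>x. (_ has_derivative _) (at x)"], OF this]
  have "((\<lambda>t. P_AW A (w + (t - w $ k) *\<^sub>R axis k 1) n) has_derivative
      (\<lambda>s. \<Sum>i\<in>UNIV. (s *\<^sub>R axis k 1) $ i * ?D i)) (at (w $ k))"
    by (rule has_derivative_compose[OF c P])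
  moreover have "(\<lambda>s. \<Sum>i\<in>UNIV. (s *\<^sub>R axis k 1) $ i * ?D i) = (*) (?D k)"
  proof
    fix s :: real
    have "(s *\<^sub>R axis k 1) $ i * ?D i = (if i = k then s * ?D k else 0)" for i
      by (simp add: axis_def)
    then have "(\<Sum>i\<in>UNIV. (s *\<^sub>R axis k 1) $ i * ?D i) = s * ?D k"
      by (simp only: sum.delta' sum.delta finite UNIV_I if_True)
    then show "(\<Sum>i\<in>UNIV. (s *\<^sub>R axis k 1) $ i * ?D i) = ?D k * s"
      by (simp only: mult.commute)
  qed
  ultimately show "((\<lambda>t. P_AW A (\<chi> i. if i = k then t else w $ i) n) has_real_derivative ?D k) (at (w $ k))"
    unfolding curve has_field_derivative_def by simp
next
  fix w k assume w: "w \<in> weight_domain A"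
  show "(\<lambda>n. real (n $ k) * P_AW A w n) summable_on UNIV"
    by (rule photon_statistics(5)[OF assms w])
  have "cov_V A w $ p $ p = matrix_inv (mat 1 - coupling (A_W A w)) $ p $ p - 1 / 2" for p
    unfolding cov_V_def X_mat_calA_W coupling_def[symmetric] by (simp add: mat_def[of "1 / 2"])
  \<comment> \<open>Two entries, each \<open>1 + mean_photons A w k - 1 / 2\<close>, minus 1 leave
    twice the mean.\<close>
  then show "complex_of_real (mean_photons A w k) = (cov_V A w $ Inl k $ Inl k + cov_V A w $ Inr k $ Inr k - 1) / 2"
    by (simp add: photon_statistics(3,4)[OF assms w])
next
  fix S :: "(real ^ 'd) set" and w \<theta> n
  assume S: "open S \<and> w differentiable_on S \<and> w ` S \<subseteq> weight_domain A" and \<theta>: "\<theta> \<in> S"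
  then have w: "w \<theta> \<in> weight_domain A" and "w differentiable (at \<theta>)"
    by (auto simp: differentiable_on_eq_differentiable_at)
  then obtain w' where w': "(w has_derivative w') (at \<theta>)"
    by (auto simp: differentiable_def)
  have pos: "w \<theta> $ k > 0" for k
    using w by (simp add: weight_domain_def)
  have P: "((\<lambda>\<theta>. P_AW A (w \<theta>) n) has_derivative
      (\<lambda>h. \<Sum>k\<in>UNIV. w' h $ k * ((real (n $ k) - mean_photons A (w \<theta>) k) / w \<theta> $ k * P_AW A (w \<theta>) n))) (at \<theta>)"
    by (rule has_derivative_compose[OF w' has_derivative_P_AW[OF assms w]])
  then show "(\<lambda>\<theta>. P_AW A (w \<theta>) n) differentiable (at \<theta>)"
    by (auto simp: differentiable_def)
  \<comment> \<open>The factor \<open>1 / w \<theta> $ k\<close> in the derivative of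
    \<open>P_AW\<close> is absorbed by the logarithm.\<close>
  have ln: "((\<lambda>\<theta>. ln (w \<theta> $ k)) has_derivative (\<lambda>h. w' h $ k * inverse (w \<theta> $ k))) (at \<theta>)" for k
    using bounded_linear.has_derivative[OF bounded_linear_vec_nth w'] pos
    by (intro has_derivative_ln) auto
  show "gradient (\<lambda>\<theta>. P_AW A (w \<theta>) n) \<theta>
      = (\<Sum>k\<in>UNIV. ((real (n $ k) - mean_photons A (w \<theta>) k) * P_AW A (w \<theta>) n)
          *\<^sub>R gradient (\<lambda>\<theta>. ln (w \<theta> $ k)) \<theta>)"
    by (simp add: vec_eq_iff gradient_nth[OF P] gradient_nth[OF ln] divide_inverse mult_ac)
qed

end
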